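(* Let $\mathcal{V}$ be a Banach space, $T>0$, and let $\gamma\in C^{0,2-var}([0,T],\mathcal{V})$ (a continuous path of vanishing $2$-variation). Then $\gamma\in\mathcal{G}_2(\mathcal{V})$ (i.e. $\gamma$ can be enhanced into a geometric $2$-rough path) if and only if the areas $A(\gamma^{D})$ of the piecewise linear interpolations $\gamma^D$ of $\gamma$ converge in $1$-variation on $[0,T]$ as $|D|\to 0$, where $D$ ranges over finite partitions of $[0,T]$.
   Context: A finite partition of $[0,T]$ is $D=\{t_j\}_{j=0}^n$ with $0=t_0<\dots<t_n=T$; its mesh is $|D|=\max_j|t_{j+1}-t_j|$. Let $\triangle_{[0,T]}=\{(s,t):0\le s\le t\le T\}$, and for a Banach space $\mathcal{W}$ let $C(\triangle_{[0,T]},\mathcal{W})$ be the continuous $\alpha:\triangle_{[0,T]}\to\mathcal{W}$ with $\alpha(t,t)=0$ for all $t$. For $p>0$, $\|\alpha\|_{p-var,[0,T]}=(\sup_{D}\sum_{t_j\in D}\|\alpha(t_j,t_{j+1})\|^p)^{1/p}$ (sup over all finite partitions $D$ of $[0,T]$), and $\omega_p(\alpha,\delta)=(\sup_{|D|\le\delta}\sum_{t_j\in D}\|\alpha(t_j,t_{j+1})\|^p)^{1/p}$; $\alpha$ is of vanishing $p$-variation if $\lim_{\delta\to0}\omega_p(\alpha,\delta)=0$. For a continuous path $\gamma:[0,T]\to\mathcal{V}$ these notions are applied to $(s,t)\mapsto\gamma(t)-\gamma(s)$. $C^{p-var}$ denotes finite $p$-variation and $C^{0,p-var}$ vanishing $p$-variation.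 For a finite partition $D$, $\gamma^D$ is the continuous path that coincides with $\gamma$ on the points of $D$ and is linear on each $[t_j,t_{j+1}]$. $\mathcal{V}\otimes\mathcal{V}$ is the completion of the algebraic tensor product in a norm satisfying $\|v\otimes u\|\le\|v\|\|u\|$; $[v_1,v_2]=v_1\otimes v_2-v_2\otimes v_1$; $[\mathcal{V},\mathcal{V}]$ is the closure in $\mathcal V\otimes\mathcal V$ of the span of all $[v_1,v_2]$. For $\gamma\in C^{1-var}([0,T],\mathcal{V})$ the area is $A(\gamma)(s,t)=\frac12\iint_{s<u_1<u_2<t}[d\gamma(u_1),d\gamma(u_2)]$, an element of $C(\triangle_{[0,T]},[\mathcal V,\mathcal V])$. A pair $(\gamma,\alpha)$ with $\gamma\in C([0,T],\mathcal{V})$ and $\alpha\in C(\triangle_{[0,T]},[\mathcal{V},\mathcal{V}])$ is a geometric $2$-rough path if there exist $\gamma_n\in C^{1-var}([0,T],\mathcal{V})$ with $\left(\|\gamma-\gamma_n\|_{2-var,[0,T]}^2+\|\alpha-A(\gamma_n)\|_{1-var,[0,T]}\right)^{1/2}\to0$. $\mathcal{G}_2(\mathcal{V})\subseteq C^{0,2-var}([0,T],\mathcal{V})$ is the set of paths $\gamma$ for which there exists $\alpha$ such that $(\gamma,\alpha)$ is a geometric $2$-rough path. *)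

theory Defs
  imports "HOL-Analysis.Analysis" "HOL-Library.Poly_Mapping"
begin

section \<open>Partitions\<close>

definition time_partition :: "real \<Rightarrow> real \<Rightarrow> real list \<Rightarrow> bool" where
  "time_partition s t D \<longleftrightarrow> D \<noteq> [] \<and> hd D = s \<and> last D = t \<and> sorted_wrt (<) D"

text \<open>The \<open>0\<close> is inserted only for the one-point partition \<open>[s]\<close> of a degenerate interval.\<close>
definition mesh :: "real list \<Rightarrow> real" where
  "mesh D = Max (insert 0 {D ! Suc j - D ! j | j. Suc j < length D})"

definition mesh_to_0 :: "real \<Rightarrow> real list filter" where
  "mesh_to_0 T = inf (filtercomap mesh (nhds 0)) (principal {D. time_partition 0 T D})"

section \<open>Functions on the triangle and \<open>p\<close>-variation\<close>

definition triangle :: "real \<Rightarrow> (real \<times> real) set" where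
  "triangle T = {(s, t). 0 \<le> s \<and> s \<le> t \<and> t \<le> T}"

definition C_triangle :: "real \<Rightarrow> 'w set \<Rightarrow> (real \<times> real \<Rightarrow> 'w::real_normed_vector) set" where
  "C_triangle T S =
     {\<alpha>. continuous_on (triangle T) \<alpha> \<and> \<alpha> ` triangle T \<subseteq> S \<and> (\<forall>t\<in>{0..T}. \<alpha> (t, t) = 0)}"

definition increments :: "(real \<Rightarrow> 'v::real_normed_vector) \<Rightarrow> real \<times> real \<Rightarrow> 'v" where
  "increments \<gamma> = (\<lambda>(s, t). \<gamma> t - \<gamma> s)"

definition var_sum :: "real \<Rightarrow> (real \<times> real \<Rightarrow> 'w::real_normed_vector) \<Rightarrow> real list \<Rightarrow> real" where
  "var_sum p \<alpha> D = (\<Sum>j<length D - 1. norm (\<alpha> (D ! j, D ! Suc j)) powr p)"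

text \<open>Variations take values in \<^typ>\<open>ennreal\<close>, so that an infinite supremum is \<open>\<infinity>\<close>.\<close>
definition ennreal_powr :: "ennreal \<Rightarrow> real \<Rightarrow> ennreal" where
  "ennreal_powr x q = (if x = \<infinity> then \<infinity> else ennreal (enn2real x powr q))"

definition pvar :: "real \<Rightarrow> real \<Rightarrow> (real \<times> real \<Rightarrow> 'w::real_normed_vector) \<Rightarrow> ennreal" where
  "pvar p T \<alpha> = ennreal_powr (SUP D\<in>{D. time_partition 0 T D}. ennreal (var_sum p \<alpha> D)) (1 / p)"

definition pvar_modulus ::
    "real \<Rightarrow> real \<Rightarrow> (real \<times> real \<Rightarrow> 'w::real_normed_vector) \<Rightarrow> real \<Rightarrow> ennreal" where
  "pvar_modulus p T \<alpha> \<delta> =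
     ennreal_powr (SUP D\<in>{D. time_partition 0 T D \<and> mesh D \<le> \<delta>}. ennreal (var_sum p \<alpha> D)) (1 / p)"

definition vanishing_pvar :: "real \<Rightarrow> real \<Rightarrow> (real \<times> real \<Rightarrow> 'w::real_normed_vector) \<Rightarrow> bool" where
  "vanishing_pvar p T \<alpha> \<longleftrightarrow> (pvar_modulus p T \<alpha> \<longlongrightarrow> 0) (at_right 0)"

definition C_pvar :: "real \<Rightarrow> real \<Rightarrow> (real \<Rightarrow> 'v::real_normed_vector) set" where
  "C_pvar p T = {\<gamma>. continuous_on {0..T} \<gamma> \<and> pvar p T (increments \<gamma>) < \<infinity>}"

definition C0_pvar :: "real \<Rightarrow> real \<Rightarrow> (real \<Rightarrow> 'v::real_normed_vector) set" where
  "C0_pvar p T = {\<gamma>. continuous_on {0..T} \<gamma> \<and> vanishing_pvar p T (increments \<gamma>)}"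

section \<open>Piecewise linear interpolation\<close>

text \<open>Only the values on \<open>[hd D, last D]\<close> matter.\<close>
fun pl_interp :: "(real \<Rightarrow> 'v::real_normed_vector) \<Rightarrow> real list \<Rightarrow> real \<Rightarrow> 'v" where
  "pl_interp \<gamma> (a # b # D) u =
     (if u \<le> b then linepath (\<gamma> a) (\<gamma> b) ((u - a) / (b - a)) else pl_interp \<gamma> (b # D) u)"
| "pl_interp \<gamma> [a] u = \<gamma> a"
| "pl_interp \<gamma> [] u = 0"

lemma sorted_wrt_less_nth_mono:
  fixes D :: "real list"
  assumes "sorted_wrt (<) D" "i \<le> j" "j < length D"
  shows "D ! i \<le> D ! j"
  using assms sorted_wrt_nth_less[of "(<)" D i j] by (cases "i = j") auto

lemma pl_interp_segment:
  assumes "sorted_wrt (<) D" "Suc j < length D" "D ! j \<le> u" "u \<le> D ! Suc j"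
  shows "pl_interp \<gamma> D u =
    linepath (\<gamma> (D ! j)) (\<gamma> (D ! Suc j)) ((u - D ! j) / (D ! Suc j - D ! j))"
  using assms
proof (induction \<gamma> D u arbitrary: j rule: pl_interp.induct)
  case (1 \<gamma> a b D u)
  show ?case
  proof (cases j)
    case 0
    then show ?thesis using 1 by auto
  next
    case (Suc i)
    have srt: "sorted_wrt (<) (b # D)" using 1 by simp
    have len: "Suc i < length (b # D)" using 1(3) Suc by simp
    have lo: "(b # D) ! i \<le> u" and hi: "u \<le> (b # D) ! Suc i" using 1(4,5) Suc by auto
    show ?thesis
    proof (cases "u \<le> b")
      case False
      then show ?thesis using 1(1)[OF False srt len lo hi] Suc by simp
    next
      case True
      have "b \<le> (b # D) ! i" using sorted_wrt_less_nth_mono[OF srt, of 0 i] len by simp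
      then have u: "u = b" and bi: "(b # D) ! i = b" using True lo by auto
      have "i = 0"
      proof (rule ccontr)
        assume "i \<noteq> 0"
        then have "(b # D) ! 0 < (b # D) ! i" using sorted_wrt_nth_less[OF srt, of 0 i] len by simp
        then show False using bi by simp
      qed
      moreover have "a < b" using 1(2) by simp
      ultimately show ?thesis using Suc u by (simp add: linepath_def)
    qed
  qed
qed auto

section \<open>Iterated Stieltjes integrals and the area\<close>

text \<open>Limit of the tagged Riemann--Stieltjes sums of \<open>\<integral> m (f u) (dg u)\<close> over \<open>[s, t]\<close> as the mesh
  tends to 0; in a pair \<open>(D, \<xi>)\<close> the tag \<open>\<xi> j\<close> belongs to \<open>[D ! j, D ! Suc j]\<close>.\<close>

definition tagged_mesh_to_0 :: "real \<Rightarrow> real \<Rightarrow> (real list \<times> (nat \<Rightarrow> real)) filter" where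
  "tagged_mesh_to_0 s t =
     inf (filtercomap (\<lambda>(D, \<xi>). mesh D) (nhds 0))
         (principal {(D, \<xi>). time_partition s t D \<and>
            (\<forall>j. Suc j < length D \<longrightarrow> \<xi> j \<in> {D ! j .. D ! Suc j})})"

definition rs_integral ::
    "('a \<Rightarrow> 'v::real_normed_vector \<Rightarrow> 'w::real_normed_vector) \<Rightarrow>
      (real \<Rightarrow> 'a) \<Rightarrow> (real \<Rightarrow> 'v) \<Rightarrow> real \<Rightarrow> real \<Rightarrow> 'w" where
  "rs_integral m f g s t =
     Lim (tagged_mesh_to_0 s t)
       (\<lambda>(D, \<xi>). \<Sum>j<length D - 1. m (f (\<xi> j)) (g (D ! Suc j) - g (D ! j)))"

lemma ex_time_partition:
  assumes "s \<le> t" "0 < \<delta>"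
  shows "\<exists>D. time_partition s t D \<and> \<bar>mesh D\<bar> < \<delta>"
proof (cases "s = t")
  case True
  then show ?thesis using assms by (intro exI[of _ "[s]"]) (auto simp: time_partition_def mesh_def)
next
  case False
  then have st: "s < t" using assms by simp
  obtain N :: nat where N: "(t - s) / \<delta> < real N" using reals_Archimedean2 by blast
  have "0 < (t - s) / \<delta>" using st assms by simp
  then have N0: "N > 0" using N by (cases N) auto
  define f where "f j = s + real j * ((t - s) / real N)" for j
  define D where "D = map f [0..<Suc N]"
  have nth: "D ! j = f j" if "j < Suc N" for j using that unfolding D_def by (simp del: upt_Suc)
  have len: "length D = Suc N" by (simp add: D_def)
  have step: "f (Suc j) - f j = (t - s) / real N" for j by (simp add: f_def algebra_simps add_divide_distrib diff_divide_distrib)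
  have ne: "D \<noteq> []" using len by auto
  have hd: "hd D = s" using nth[of 0] ne by (simp add: hd_conv_nth f_def)
  have last: "last D = t" using nth[of N] ne len N0 by (simp add: last_conv_nth f_def)
  have fm: "f i < f j" if "i < j" for i j using that st N0 by (simp add: f_def divide_strict_right_mono)
  have srt: "sorted_wrt (<) D" unfolding sorted_wrt_iff_nth_less using nth len fm by auto
  have "{D ! Suc j - D ! j | j. Suc j < length D} = {(t - s) / real N}"
    using nth len step N0 by (auto intro!: exI[of _ 0])
  then have "mesh D = (t - s) / real N" using st by (simp add: mesh_def)
  moreover have "(t - s) / real N < \<delta>" using N N0 assms by (simp add: field_simps)
  ultimately show ?thesis using ne hd last srt st by (auto simp: time_partition_def)
qed

lemma tagged_mesh_to_0_neq_bot:
  assumes "s \<le> t"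
  shows "tagged_mesh_to_0 s t \<noteq> bot"
proof
  assume "tagged_mesh_to_0 s t = bot"
  then have "eventually (\<lambda>_. False) (tagged_mesh_to_0 s t)" by simp
  then obtain Q where Q: "eventually Q (nhds (0::real))" and imp: "\<And>D \<xi>. Q (mesh D) \<Longrightarrow>
     \<not> (time_partition s t D \<and> (\<forall>j. Suc j < length D \<longrightarrow> \<xi> j \<in> {D ! j .. D ! Suc j}))"
    unfolding tagged_mesh_to_0_def eventually_inf_principal eventually_filtercomap by fastforce
  from Q obtain d where d: "d > 0" "\<And>x. \<bar>x\<bar> < d \<Longrightarrow> Q x"
    unfolding eventually_nhds_metric by (auto simp: dist_real_def)
  from ex_time_partition[OF assms d(1)] obtain D where D: "time_partition s t D" "\<bar>mesh D\<bar> < d" by blast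
  from D have "\<forall>j. Suc j < length D \<longrightarrow> D ! j \<in> {D ! j .. D ! Suc j}"
    by (auto simp: time_partition_def sorted_wrt_iff_nth_less order.strict_implies_order)
  then show False using imp[of D "\<lambda>j. D ! j"] D d by blast
qed

lemma rs_integral_1:
  assumes "s \<le> t"
  shows "rs_integral (*\<^sub>R) (\<lambda>_. 1) \<gamma> s t = \<gamma> t - \<gamma> s"
  unfolding rs_integral_def
proof (rule tendsto_Lim[OF tagged_mesh_to_0_neq_bot[OF assms]], rule tendsto_eventually)
  have *: "(\<Sum>j<length D - 1. \<gamma> (D ! Suc j) - \<gamma> (D ! j)) = \<gamma> t - \<gamma> s"
    if "time_partition s t D" for D
    using that by (auto simp: time_partition_def hd_conv_nth last_conv_nth sum_lessThan_telescope[of "\<lambda>j. \<gamma> (D ! j)" for D])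
  show "eventually (\<lambda>x. (case x of (D, \<xi>) \<Rightarrow> \<Sum>j<length D - 1. 1 *\<^sub>R (\<gamma> (D ! Suc j) - \<gamma> (D ! j)))
      = \<gamma> t - \<gamma> s) (tagged_mesh_to_0 s t)"
    unfolding tagged_mesh_to_0_def eventually_inf_principal
    using * by (intro always_eventually) auto
qed

definition bracket :: "('v \<Rightarrow> 'v \<Rightarrow> 'w::ab_group_add) \<Rightarrow> 'v \<Rightarrow> 'v \<Rightarrow> 'w" where
  "bracket tns v u = tns v u - tns u v"

text \<open>The double integral over \<open>s < u1 < u2 < t\<close> is the iterated one: the inner integral
  \<open>\<integral> d\<gamma>(u1)\<close> runs over \<open>[s, u2]\<close>, the outer one over \<open>[s, t]\<close>.\<close>
definition area ::
    "('v::real_normed_vector \<Rightarrow> 'v \<Rightarrow> 'w::real_normed_vector) \<Rightarrow> (real \<Rightarrow> 'v) \<Rightarrow> real \<times> real \<Rightarrow> 'w" where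
  "area tns \<gamma> = (\<lambda>(s, t). (1/2) *\<^sub>R
     rs_integral (bracket tns) (\<lambda>u2. rs_integral (*\<^sub>R) (\<lambda>u1. 1) \<gamma> s u2) \<gamma> s t)"

section \<open>Completed tensor products\<close>

text \<open>The algebraic tensor product of \<open>V\<close> with itself is the free vector space on \<open>V \<times> V\<close>, that is
  \<^typ>\<open>('v \<times> 'v) \<Rightarrow>\<^sub>0 real\<close>, modulo the following subspace.\<close>

inductive_set tensor_relations :: "(('v::real_vector \<times> 'v) \<Rightarrow>\<^sub>0 real) set" where
  add_left: "Poly_Mapping.single (v + v', u) 1 - Poly_Mapping.single (v, u) 1
      - Poly_Mapping.single (v', u) 1 \<in> tensor_relations"
| add_right: "Poly_Mapping.single (v, u + u') 1 - Poly_Mapping.single (v, u) 1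
      - Poly_Mapping.single (v, u') 1 \<in> tensor_relations"
| scale_left: "Poly_Mapping.single (r *\<^sub>R v, u) 1 - Poly_Mapping.single (v, u) r \<in> tensor_relations"
| scale_right: "Poly_Mapping.single (v, r *\<^sub>R u) 1 - Poly_Mapping.single (v, u) r \<in> tensor_relations"
| zero: "0 \<in> tensor_relations"
| add: "x \<in> tensor_relations \<Longrightarrow> y \<in> tensor_relations \<Longrightarrow> x + y \<in> tensor_relations"
| scale: "x \<in> tensor_relations \<Longrightarrow> Poly_Mapping.map ((*) r) x \<in> tensor_relations"

definition tensor_extension :: "('v \<Rightarrow> 'v \<Rightarrow> 'w::real_vector) \<Rightarrow> (('v \<times> 'v) \<Rightarrow>\<^sub>0 real) \<Rightarrow> 'w" where
  "tensor_extension tns c =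
     (\<Sum>(v, u)\<in>Poly_Mapping.keys c. Poly_Mapping.lookup c (v, u) *\<^sub>R tns v u)"

text \<open>The Banach space \<^typ>\<open>'w\<close> with the map \<open>tns\<close> is a completion of the algebraic tensor product in
  some norm with \<open>\<parallel>v \<otimes> u\<parallel> \<le> \<parallel>v\<parallel> \<parallel>u\<parallel>\<close>: the canonical map out of the quotient is well defined
  (bilinearity), injective (no further relations), and has dense range.\<close>
definition completed_tensor_product :: "('v::banach \<Rightarrow> 'v \<Rightarrow> 'w::banach) \<Rightarrow> bool" where
  "completed_tensor_product tns \<longleftrightarrow>
     bilinear tns \<and>
     (\<forall>c. tensor_extension tns c = 0 \<longrightarrow> c \<in> tensor_relations) \<and>
     closure (range (tensor_extension tns)) = UNIV \<and>
     (\<forall>v u. norm (tns v u) \<le> norm v * norm u)"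

definition bracket_space :: "('v \<Rightarrow> 'v \<Rightarrow> 'w::real_normed_vector) \<Rightarrow> 'w set" where
  "bracket_space tns = closure (span {bracket tns v u | v u. True})"

section \<open>Geometric \<open>2\<close>-rough paths\<close>

definition geometric_2_rough_path ::
    "('v::banach \<Rightarrow> 'v \<Rightarrow> 'w::banach) \<Rightarrow> real \<Rightarrow> (real \<Rightarrow> 'v) \<Rightarrow> (real \<times> real \<Rightarrow> 'w) \<Rightarrow> bool" where
  "geometric_2_rough_path tns T \<gamma> \<alpha> \<longleftrightarrow>
     continuous_on {0..T} \<gamma> \<and> \<alpha> \<in> C_triangle T (bracket_space tns) \<and>
     (\<exists>\<gamma>n :: nat \<Rightarrow> real \<Rightarrow> 'v. (\<forall>n. \<gamma>n n \<in> C_pvar 1 T) \<and>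
        (\<lambda>n. ennreal_powr
            ((pvar 2 T (increments (\<lambda>u. \<gamma> u - \<gamma>n n u)))\<^sup>2
              + pvar 1 T (\<lambda>x. \<alpha> x - area tns (\<gamma>n n) x)) (1/2)) \<longlonglongrightarrow> 0)"

definition G2 :: "('v::banach \<Rightarrow> 'v \<Rightarrow> 'w::banach) \<Rightarrow> real \<Rightarrow> (real \<Rightarrow> 'v) set" where
  "G2 tns T = {\<gamma> \<in> C0_pvar 2 T. \<exists>\<alpha>. geometric_2_rough_path tns T \<gamma> \<alpha>}"

definition areas_converge_in_1var ::
    "('v::banach \<Rightarrow> 'v \<Rightarrow> 'w::banach) \<Rightarrow> real \<Rightarrow> (real \<Rightarrow> 'v) \<Rightarrow> bool" where
  "areas_converge_in_1var tns T \<gamma> \<longleftrightarrow>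
     (\<exists>\<alpha> \<in> C_triangle T (bracket_space tns).
        ((\<lambda>D. pvar 1 T (\<lambda>x. area tns (pl_interp \<gamma> D) x - \<alpha> x)) \<longlongrightarrow> 0) (mesh_to_0 T))"

end

theory Submission
  imports Defs
begin

text \<open>If \<open>A(\<gamma>\<^sup>D)\<close> converges to \<open>\<alpha>\<close>, then the paths \<open>\<gamma>\<^sup>D\<close> themselves witness that \<open>(\<gamma>, \<alpha>)\<close> is a geometric
  rough path, because vanishing \<open>2\<close>-variation gives \<open>\<gamma>\<^sup>D \<rightarrow> \<gamma>\<close> in \<open>2\<close>-variation.

  Conversely let \<open>(\<gamma>, \<alpha>)\<close> be geometric. The area of a continuous path of bounded variation satisfies
  Chen's relation and has vanishing \<open>1\<close>-variation, and both properties pass to \<open>\<alpha>\<close>. Put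
  \<open>\<phi> = \<alpha> - A(\<gamma>\<^sup>D)\<close>. Areas vanish on linear pieces and the bracket terms of Chen's relation agree for \<open>\<gamma>\<close>
  and \<open>\<gamma>\<^sup>D\<close> on \<open>D\<close>, so \<open>\<phi>\<close> is additive on \<open>D\<close> and equals \<open>\<Sum> \<alpha>(t\<^sub>j, t\<^sub>j\<^sub>+\<^sub>1)\<close> between points of \<open>D\<close>. For
  arbitrary \<open>E\<close> the \<open>1\<close>-variation sum of \<open>\<phi>\<close> along \<open>E\<close> is therefore at most that of \<open>\<alpha>\<close> along \<open>E \<union> D\<close>, which is
  small, plus products of increments of \<open>\<gamma> - \<gamma>\<^sup>D\<close> (small in \<open>2\<close>-variation) and of \<open>\<gamma>\<close> (bounded in
  \<open>2\<close>-variation).\<close>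

section \<open>Partitions as finite sets\<close>

text \<open>With sets in place of lists a common refinement is just a union. The point \<open>nxt X x\<close> is meaningful
  only if \<open>X\<close> has an element above \<open>x\<close>, and \<open>psum F X s t\<close> runs over the consecutive pairs of \<open>X\<close> in
  \<open>[s, t]\<close> only if \<open>t \<in> X\<close>; the set \<open>X\<close> may extend beyond \<open>[s, t]\<close>.\<close>

definition is_partition :: "real \<Rightarrow> real \<Rightarrow> real set \<Rightarrow> bool" where
  "is_partition s t X \<longleftrightarrow> finite X \<and> s \<in> X \<and> t \<in> X \<and> X \<subseteq> {s..t}"

definition nxt :: "real set \<Rightarrow> real \<Rightarrow> real" where
  "nxt X x = Min {y \<in> X. x < y}"

definition psum :: "(real \<Rightarrow> real \<Rightarrow> 'a::comm_monoid_add) \<Rightarrow> real set \<Rightarrow> real \<Rightarrow> real \<Rightarrow> 'a" where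
  "psum F X s t = (\<Sum>x \<in> X \<inter> {s..<t}. F x (nxt X x))"

definition gaps_le :: "real \<Rightarrow> real set \<Rightarrow> real \<Rightarrow> real \<Rightarrow> bool" where
  "gaps_le \<delta> X s t \<longleftrightarrow> (\<forall>x \<in> X \<inter> {s..<t}. nxt X x - x \<le> \<delta>)"

section \<open>Successor points in a finite set\<close>

lemma nxt:
  assumes "finite X" "y \<in> X" "x < y"
  shows "nxt X x \<in> X" "x < nxt X x" "nxt X x \<le> y"
proof -
  have f: "finite {y \<in> X. x < y}" "{y \<in> X. x < y} \<noteq> {}" using assms by auto
  show "nxt X x \<in> X" "x < nxt X x" using Min_in[OF f] by (auto simp: nxt_def)
  show "nxt X x \<le> y" using assms f by (auto simp: nxt_def)
qed

lemma nxt_eqI: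
  assumes "finite X" "y \<in> X" "x < y" "X \<inter> {x<..<y} = {}"
  shows "nxt X x = y"
proof (rule antisym)
  show "nxt X x \<le> y" by (rule nxt) fact+
  show "y \<le> nxt X x"
    using nxt[OF assms(1-3)] assms(4) by (metis Int_iff empty_iff greaterThanLessThan_iff not_le)
qed

lemma nxt_empty: "finite X \<Longrightarrow> y \<in> X \<Longrightarrow> x < y \<Longrightarrow> X \<inter> {x<..<nxt X x} = {}"
  using nxt(3)[of X _ x] by force

lemma nxt_cong:
  assumes "finite X" "finite Y" "y \<in> X" "x < y" "X \<inter> {x..y} = Y \<inter> {x..y}"
  shows "nxt X x = nxt Y x"
proof -
  have "y \<in> Y" using assms(3-5) by (metis IntD1 IntI atLeastAtMost_iff less_imp_le order_refl)
  note n = nxt[OF assms(2) this assms(4)]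
  have "Y \<inter> {x<..<nxt Y x} = {}" by (rule nxt_empty) fact+
  then have "X \<inter> {x<..<nxt Y x} = {}" using assms(5) n by force
  moreover have "nxt Y x \<in> X" using n assms(5) by (metis IntD1 IntI atLeastAtMost_iff less_imp_le)
  ultimately show ?thesis using nxt_eqI[OF assms(1)] n by blast
qed

section \<open>Sums over consecutive points\<close>

lemma psum_same [simp]: "psum F X s s = 0"
  by (simp add: psum_def)

lemma psum_cong_set:
  assumes "finite X" "finite Y" "t \<in> X" "X \<inter> {s..t} = Y \<inter> {s..t}"
  shows "psum F X s t = psum F Y s t"
  unfolding psum_def
proof (rule sum.cong)
  have "{s..<t} \<subseteq> {s..t}" by auto
  then show "X \<inter> {s..<t} = Y \<inter> {s..<t}" using assms(4) by blast
  fix x assume "x \<in> Y \<inter> {s..<t}"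
  moreover then have "{x..t} \<subseteq> {s..t}" by auto
  then have "X \<inter> {x..t} = Y \<inter> {x..t}" using assms(4) by blast
  ultimately have "nxt X x = nxt Y x" using assms(1-3) by (intro nxt_cong[where y = t]) auto
  then show "F x (nxt X x) = F x (nxt Y x)" by simp
qed

text \<open>The cut point \<open>u\<close> may lie off \<open>X\<close>: the sum is indexed by left
  endpoints, and their half-open ranges are disjoint. A cell straddling \<open>u\<close> is counted
  whole in the left sum.\<close>

lemma psum_split:
  assumes "finite X" "s \<le> u" "u \<le> t"
  shows "psum F X s t = psum F X s u + psum F X u t"
proof -
  have "X \<inter> {s..<t} = (X \<inter> {s..<u}) \<union> (X \<inter> {u..<t})" using assms by auto
  then show ?thesis unfolding psum_def using assms by (simp, subst sum.union_disjoint) auto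
qed

lemma psum_one:
  assumes "finite X" "s \<in> X" "t \<in> X" "s < t" "X \<inter> {s<..<t} = {}"
  shows "psum F X s t = F s t"
proof -
  have "X \<inter> {s..<t} = {s}" using assms by (force simp: less_le)
  then show ?thesis using nxt_eqI[of X t s] assms by (simp add: psum_def)
qed

text \<open>Induction on the number of left endpoints, peeling off the first cell. Additivity is
  asked for at points of \<open>X\<close>, which suits interval functions that are additive just on
  the nodes of a partition.\<close>

lemma psum_additive:
  fixes H :: "real \<Rightarrow> real \<Rightarrow> 'a::ab_group_add"
  assumes "finite X" "s \<in> X" "t \<in> X" "s \<le> t"
    and add: "\<And>a b c. a \<in> X \<Longrightarrow> b \<in> X \<Longrightarrow> c \<in> X \<Longrightarrow> s \<le> a \<Longrightarrow> a \<le> b \<Longrightarrow> b \<le> c \<Longrightarrow> c \<le> t \<Longrightarrow> H a c = H a b + H b c"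
  shows "psum H X s t = H s t"
  using assms
proof (induction "card (X \<inter> {s..<t})" arbitrary: s rule: less_induct)
  case less
  show ?case
  proof (cases "s = t")
    case True
    \<comment> \<open>Additivity at a triple of equal points forces \<open>H s s = 0\<close>, in
      agreement with the empty sum.\<close>
    have "H s s = H s s + H s s" using less.prems(1-4) by (intro less.prems(5)) auto
    then show ?thesis using True by simp
  next
    case False
    then have st: "s < t" using less.prems by simp
    let ?u = "nxt X s"
    note n = nxt[OF less.prems(1,3) st]
    have ps: "X \<inter> {?u..<t} \<subset> X \<inter> {s..<t}"
    proof (rule psubsetI)
      have "s \<in> X \<inter> {s..<t}" "s \<notin> X \<inter> {?u..<t}" using n st less.prems by auto
      then show "X \<inter> {?u..<t} \<noteq> X \<inter> {s..<t}" by blast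
    qed (use n in auto)
    have "psum H X ?u t = H ?u t"
    proof (rule less.hyps[OF _ _ _ _ _ less.prems(5)])
      show "card (X \<inter> {?u..<t}) < card (X \<inter> {s..<t})"
        using less.prems(1) by (intro psubset_card_mono ps) auto
    qed (use n less.prems(1-4) in auto)
    moreover have "psum H X s ?u = H s ?u"
      using n less.prems(1-4) st by (intro psum_one nxt_empty[of X t]) auto
    moreover have "H s t = H s ?u + H ?u t"
      using n less.prems(1-4) by (intro less.prems(5)) auto
    ultimately show ?thesis
      using psum_split[of X s ?u t H] n less.prems(1-4) by simp
  qed
qed

lemma psum_telescope:
  fixes g :: "real \<Rightarrow> 'a::ab_group_add"
  assumes "finite X" "s \<in> X" "t \<in> X" "s \<le> t"
  shows "psum (\<lambda>a b. g b - g a) X s t = g t - g s"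
  using assms by (intro psum_additive) auto

text \<open>By \<open>psum_split\<close>, \<open>psum F Z\<close> is itself additive in its
  interval, so its sum over the cells of \<open>X\<close> collapses. This is how cellwise estimates
  are added up.\<close>

lemma psum_refine:
  fixes F :: "real \<Rightarrow> real \<Rightarrow> 'a::ab_group_add"
  assumes "finite X" "finite Z" "s \<in> X" "t \<in> X" "s \<le> t"
  shows "psum (psum F Z) X s t = psum F Z s t"
  using assms by (intro psum_additive psum_split) auto

lemma psum_cong:
  assumes "finite X" "t \<in> X" "\<And>a. a \<in> X \<Longrightarrow> s \<le> a \<Longrightarrow> a < t \<Longrightarrow> F a (nxt X a) = G a (nxt X a)"
  shows "psum F X s t = psum G X s t"
  unfolding psum_def using assms by (intro sum.cong) auto

lemma psum_mono:
  fixes F :: "real \<Rightarrow> real \<Rightarrow> real"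
  assumes "\<And>a. a \<in> X \<Longrightarrow> s \<le> a \<Longrightarrow> a < t \<Longrightarrow> F a (nxt X a) \<le> G a (nxt X a)"
  shows "psum F X s t \<le> psum G X s t"
  unfolding psum_def using assms by (intro sum_mono) auto

lemma psum_nonneg:
  fixes F :: "real \<Rightarrow> real \<Rightarrow> real"
  assumes "\<And>a b. 0 \<le> F a b"
  shows "0 \<le> psum F X s t"
  unfolding psum_def using assms by (intro sum_nonneg) auto

lemma norm_psum: "norm (psum F X s t) \<le> psum (\<lambda>a b. norm (F a b)) X s t"
  unfolding psum_def by (rule norm_sum)

lemma psum_add: "psum (\<lambda>a b. F a b + G a b) X s t = psum F X s t + psum G X s t"
  by (simp add: psum_def sum.distrib)

lemma psum_diff:
  fixes F :: "real \<Rightarrow> real \<Rightarrow> 'a::ab_group_add"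
  shows "psum (\<lambda>a b. F a b - G a b) X s t = psum F X s t - psum G X s t"
  by (simp add: psum_def sum_subtractf)

lemma psum_cmult:
  fixes c :: real
  shows "psum (\<lambda>a b. c * F a b) X s t = c * psum F X s t"
  by (simp add: psum_def sum_distrib_left)

lemma psum_mono_interval:
  fixes F :: "real \<Rightarrow> real \<Rightarrow> real"
  assumes "finite X" "s' \<le> s" "t \<le> t'" "\<And>a b. 0 \<le> F a b"
  shows "psum F X s t \<le> psum F X s' t'"
  unfolding psum_def using assms by (intro sum_mono2) auto

section \<open>Cells of a partition and of its refinements\<close>

lemma locate:
  assumes "finite X" "s \<in> X" "t \<in> X" "s \<le> c" "c < t"
  obtains a where "a \<in> X" "s \<le> a" "a \<le> c" "c < nxt X a" "a < t"
proof
  let ?S = "{x \<in> X. x \<le> c}"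
  have f: "finite ?S" "?S \<noteq> {}" using assms by auto
  let ?a = "Max ?S"
  have m: "?a \<in> ?S" by (rule Max_in[OF f])
  show "?a \<in> X" "?a \<le> c" using m by auto
  show "s \<le> ?a" using assms f by auto
  show at: "?a < t" using m assms by auto
  show "c < nxt X ?a"
  proof (rule ccontr)
    assume "\<not> c < nxt X ?a"
    then have "nxt X ?a \<in> ?S" using nxt[OF assms(1,3) at] by auto
    then have "nxt X ?a \<le> ?a" using f by auto
    then show False using nxt(2)[OF assms(1,3) at] by simp
  qed
qed

text \<open>The successor of \<open>a\<close> in \<open>X\<close> is also a point of
  \<open>Z\<close> above \<open>c\<close>, so the cell of \<open>Z\<close> starting at
  \<open>c\<close> cannot reach past it: every cell of \<open>Z\<close> sits inside one cell of
  \<open>X\<close>.\<close>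

lemma locate_refinement:
  assumes "finite X" "finite Z" "X \<subseteq> Z" "s \<in> X" "t \<in> X" "c \<in> Z" "s \<le> c" "c < t"
  obtains a where "a \<in> X" "s \<le> a" "a < t" "a \<le> c" "c < nxt Z c" "nxt Z c \<le> nxt X a"
proof -
  obtain a where a: "a \<in> X" "s \<le> a" "a \<le> c" "c < nxt X a" "a < t"
    using locate[OF assms(1,4,5,7,8)] by blast
  have "nxt X a \<in> Z" using nxt(1)[OF assms(1,5) a(5)] assms by auto
  then show thesis using that a nxt[OF assms(2) _ a(4)] by blast
qed

lemma gaps_le_refine:
  assumes "gaps_le \<delta> X s t" "finite X" "finite Z" "X \<subseteq> Z" "s \<in> X" "t \<in> X"
  shows "gaps_le \<delta> Z s t"
  unfolding gaps_le_def
proof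
  fix c assume "c \<in> Z \<inter> {s..<t}"
  then obtain a where "a \<in> X" "s \<le> a" "a < t" "a \<le> c" "c < nxt Z c" "nxt Z c \<le> nxt X a"
    using locate_refinement[OF assms(2-6), of c] by (metis IntD1 IntD2 atLeastLessThan_iff)
  then show "nxt Z c - c \<le> \<delta>" using assms(1) unfolding gaps_le_def by force
qed

lemma gaps_le_subinterval: "gaps_le \<delta> X s t \<Longrightarrow> s \<le> s' \<Longrightarrow> t' \<le> t \<Longrightarrow> gaps_le \<delta> X s' t'"
  by (auto simp: gaps_le_def)

lemma is_partition_Un: "is_partition s t X \<Longrightarrow> is_partition s t Y \<Longrightarrow> is_partition s t (X \<union> Y)"
  by (auto simp: is_partition_def)

lemma is_partitionD:
  assumes "is_partition s t X"
  shows "finite X" "s \<in> X" "t \<in> X" "s \<le> t" "\<And>x. x \<in> X \<Longrightarrow> s \<le> x" "\<And>x. x \<in> X \<Longrightarrow> x \<le> t"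
  using assms by (auto simp: is_partition_def)

section \<open>Translation between partitions as lists and as sets\<close>

lemma time_partition_set:
  assumes "time_partition s t D"
  shows "is_partition s t (set D)"
    and "Suc j < length D \<Longrightarrow> nxt (set D) (D ! j) = D ! Suc j"
    and "bij_betw ((!) D) {..<length D - 1} (set D \<inter> {s..<t})"
proof -
  have ne: "D \<noteq> []" and hd: "D ! 0 = s" and la: "D ! (length D - 1) = t" and so: "sorted_wrt (<) D"
    using assms by (auto simp: time_partition_def hd_conv_nth last_conv_nth)
  have mono: "D ! i \<le> D ! j" if "i \<le> j" "j < length D" for i j
    using sorted_wrt_less_nth_mono[OF so that] .
  have smono: "D ! i < D ! j" if "i < j" "j < length D" for i j
    using sorted_wrt_nth_less[OF so that(1)] that by auto
  show "is_partition s t (set D)"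
    unfolding is_partition_def
    using ne hd la mono[of 0] mono[of _ "length D - 1"]
    by (auto simp: in_set_conv_nth intro: exI[of _ 0] exI[of _ "length D - 1"]) 
  show "nxt (set D) (D ! j) = D ! Suc j" if "Suc j < length D" for j
  proof (rule nxt_eqI)
    show "set D \<inter> {D ! j<..<D ! Suc j} = {}"
    proof -
      { fix i assume i: "i < length D" "D ! j < D ! i" "D ! i < D ! Suc j"
        have False
        proof (cases "i \<le> j")
          case True then show False using mono[of i j] that i by auto
        next
          case False then show False using mono[of "Suc j" i] i by auto
        qed }
      then show ?thesis by (auto simp: in_set_conv_nth)
    qed
  qed (use that smono[of j "Suc j"] in auto)
  show "bij_betw ((!) D) {..<length D - 1} (set D \<inter> {s..<t})"
  proof (rule bij_betw_imageI)
    show "inj_on ((!) D) {..<length D - 1}"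
    proof (rule linorder_inj_onI)
      fix i j assume "i < j" "j \<in> {..<length D - 1}"
      moreover from this have "j < length D" by simp
      ultimately show "D ! i \<noteq> D ! j" using smono[of i j] by simp
    qed auto
    show "(!) D ` {..<length D - 1} = set D \<inter> {s..<t}"
    proof
      show "(!) D ` {..<length D - 1} \<subseteq> set D \<inter> {s..<t}"
        using hd la mono[of 0] smono[of _ "length D - 1"] by fastforce
      show "set D \<inter> {s..<t} \<subseteq> (!) D ` {..<length D - 1}"
      proof
        fix x assume "x \<in> set D \<inter> {s..<t}"
        then obtain i where i: "i < length D" "x = D ! i" "D ! i < t" by (auto simp: in_set_conv_nth)
        have "i \<noteq> length D - 1" using i la by auto
        then show "x \<in> (!) D ` {..<length D - 1}" using i by auto
      qed
    qed
  qed
qed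

lemma time_partition_sum:
  assumes "time_partition s t D"
  shows "(\<Sum>j<length D - 1. F (D ! j) (D ! Suc j)) = psum F (set D) s t"
proof -
  have "(\<Sum>j<length D - 1. F (D ! j) (D ! Suc j)) = (\<Sum>j<length D - 1. F (D ! j) (nxt (set D) (D ! j)))"
    using time_partition_set(2)[OF assms] by (intro sum.cong) auto
  also have "\<dots> = psum F (set D) s t"
    unfolding psum_def by (rule sum.reindex_bij_betw[OF time_partition_set(3)[OF assms]])
  finally show ?thesis .
qed

lemma time_partition_sorted_list_of_set:
  assumes "is_partition s t X"
  shows "time_partition s t (sorted_list_of_set X)"
proof -
  have f: "finite X" "X \<noteq> {}" and "s \<in> X" "t \<in> X" using assms by (auto simp: is_partition_def)
  then have ne: "sorted_list_of_set X \<noteq> []" by auto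
  let ?D = "sorted_list_of_set X"
  have so: "sorted_wrt (<) ?D" by simp
  have in_D: "x \<in> X \<longleftrightarrow> (\<exists>i<length ?D. x = ?D ! i)" for x
    using f by (metis in_set_conv_nth set_sorted_list_of_set)
  have "?D ! 0 = s"
  proof (rule antisym)
    obtain i where "i < length ?D" "s = ?D ! i" using in_D \<open>s \<in> X\<close> by auto
    then show "?D ! 0 \<le> s" using sorted_wrt_less_nth_mono[OF so, of 0 i] by auto
    have "?D ! 0 \<in> X" using f ne nth_mem[of 0 ?D] by (simp add: card_gt_0_iff)
    then show "s \<le> ?D ! 0" using assms by (auto simp: is_partition_def)
  qed
  moreover have "?D ! (length ?D - 1) = t"
  proof (rule antisym)
    obtain i where "i < length ?D" "t = ?D ! i" using in_D \<open>t \<in> X\<close> by auto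
    then show "t \<le> ?D ! (length ?D - 1)"
      using sorted_wrt_less_nth_mono[OF so, of i "length ?D - 1"] by auto
    have "?D ! (length ?D - 1) \<in> X" using in_D ne by (metis One_nat_def diff_less length_greater_0_conv lessI)
    then show "?D ! (length ?D - 1) \<le> t" using assms by (auto simp: is_partition_def)
  qed
  ultimately show ?thesis using ne so by (simp add: time_partition_def hd_conv_nth last_conv_nth)
qed

text \<open>The condition \<open>0 \<le> \<delta>\<close> accounts for the \<open>0\<close> inserted
  into the maximum in \<open>mesh\<close>; the other entries are exactly the gaps.\<close>

lemma mesh_le_iff:
  assumes "time_partition s t D" "0 \<le> \<delta>"
  shows "mesh D \<le> \<delta> \<longleftrightarrow> gaps_le \<delta> (set D) s t"
proof -
  have "finite {D ! Suc j - D ! j |j. Suc j < length D}"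
    by (rule finite_surj[of "{..<length D}" _ "\<lambda>j. D ! Suc j - D ! j"]) auto
  then have "mesh D \<le> \<delta> \<longleftrightarrow> (\<forall>j<length D - 1. D ! Suc j - D ! j \<le> \<delta>)"
    using assms(2) unfolding mesh_def by (subst Max_le_iff) (auto simp: less_diff_conv)
  also have "\<dots> \<longleftrightarrow> (\<forall>x\<in>(!) D ` {..<length D - 1}. nxt (set D) x - x \<le> \<delta>)"
    using time_partition_set(2)[OF assms(1)] by auto
  also have "(!) D ` {..<length D - 1} = set D \<inter> {s..<t}"
    using time_partition_set(3)[OF assms(1)] by (rule bij_betw_imp_surj_on)
  finally show ?thesis by (simp add: gaps_le_def)
qed

lemma mesh_nonneg: "0 \<le> mesh D"
proof -
  have "finite {D ! Suc j - D ! j |j. Suc j < length D}"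
    by (rule finite_surj[of "{..<length D}" _ "\<lambda>j. D ! Suc j - D ! j"]) auto
  then show ?thesis unfolding mesh_def by (intro Max_ge) auto
qed

text \<open>Adding points to a fine partition does not enlarge its gaps. The prescribed points of
  \<open>Y\<close> later serve as common nodes for several sums.\<close>

lemma ex_fine_partition:
  assumes "s \<le> t" "0 < \<delta>" "finite Y" "Y \<subseteq> {s..t}"
  obtains Z where "is_partition s t Z" "gaps_le \<delta> Z s t" "Y \<subseteq> Z"
proof -
  obtain D where D: "time_partition s t D" "\<bar>mesh D\<bar> < \<delta>" using ex_time_partition[OF assms(1,2)] by blast
  have p: "is_partition s t (set D)" by (rule time_partition_set[OF D(1)])
  have "gaps_le \<delta> (set D) s t" using D mesh_le_iff[OF D(1), of \<delta>] assms by auto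
  then have "gaps_le \<delta> (set D \<union> Y) s t" using assms is_partitionD[OF p]
    by (intro gaps_le_refine[where X = "set D" and Z = "set D \<union> Y"]) auto
  then show thesis using p assms by (intro that[of "set D \<union> Y"]) (auto simp: is_partition_def)
qed

section \<open>The area of a path of bounded variation\<close>

abbreviation incr_norm :: "(real \<Rightarrow> 'v::real_normed_vector) \<Rightarrow> real \<Rightarrow> real \<Rightarrow> real" where
  "incr_norm \<gamma> \<equiv> \<lambda>a b. norm (\<gamma> b - \<gamma> a)"

definition modulus_on :: "real \<Rightarrow> real \<Rightarrow> real \<Rightarrow> real \<Rightarrow> (real \<Rightarrow> 'v::real_normed_vector) \<Rightarrow> bool" where
  "modulus_on s t \<delta> \<epsilon> \<gamma> \<longleftrightarrow> (\<forall>u\<in>{s..t}. \<forall>v\<in>{s..t}. \<bar>u - v\<bar> \<le> \<delta> \<longrightarrow> norm (\<gamma> u - \<gamma> v) \<le> \<epsilon>)"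

text \<open>A bound in place of the supremum keeps the estimates in real arithmetic.\<close>

definition variation_le :: "real \<Rightarrow> real \<Rightarrow> (real \<Rightarrow> 'v::real_normed_vector) \<Rightarrow> bool" where
  "variation_le T K \<gamma> \<longleftrightarrow> (\<forall>X. is_partition 0 T X \<longrightarrow> psum (incr_norm \<gamma>) X 0 T \<le> K)"

lemma ex_modulus:
  assumes "continuous_on {s..t} \<gamma>" "0 < \<epsilon>"
  obtains \<delta> where "0 < \<delta>" "modulus_on s t \<delta> \<epsilon> \<gamma>"
proof -
  have "uniformly_continuous_on {s..t} \<gamma>" using assms by (intro compact_uniformly_continuous) auto
  then obtain d where d: "d > 0" "\<And>u v. u \<in> {s..t} \<Longrightarrow> v \<in> {s..t} \<Longrightarrow> dist v u < d \<Longrightarrow> dist (\<gamma> v) (\<gamma> u) < \<epsilon>"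
    using assms(2) unfolding uniformly_continuous_on_def by meson
  have "modulus_on s t (d/2) \<epsilon> \<gamma>"
    unfolding modulus_on_def using d by (force simp: dist_norm intro!: less_imp_le)
  then show thesis using d by (intro that[of "d/2"]) auto
qed

lemma modulus_on_subinterval: "modulus_on s t \<delta> \<epsilon> \<gamma> \<Longrightarrow> s \<le> s' \<Longrightarrow> t' \<le> t \<Longrightarrow> modulus_on s' t' \<delta> \<epsilon> \<gamma>"
  by (auto simp: modulus_on_def)

lemma variation_le_psum:
  assumes "variation_le T K \<gamma>" "finite Z" "s \<in> Z" "t \<in> Z" "0 \<le> s" "s \<le> t" "t \<le> T"
  shows "psum (incr_norm \<gamma>) Z s t \<le> K"
proof -
  \<comment> \<open>Discarding the points outside \<open>[s, t]\<close> and adding \<open>0\<close>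
    and \<open>T\<close> gives a partition of \<open>[0, T]\<close> with the same sum over
    \<open>[s, t]\<close>.\<close>
  let ?Y = "(Z \<inter> {s..t}) \<union> {0, T}"
  have p: "is_partition 0 T ?Y" using assms by (auto simp: is_partition_def)
  have "psum (incr_norm \<gamma>) Z s t = psum (incr_norm \<gamma>) ?Y s t"
    using assms by (intro psum_cong_set) auto
  also have "\<dots> \<le> psum (incr_norm \<gamma>) ?Y 0 T"
    using assms by (intro psum_mono_interval) auto
  finally show ?thesis using p assms(1) by (force simp: variation_le_def)
qed

lemma variation_le_nonneg:
  assumes "variation_le T K \<gamma>" "0 \<le> T" shows "0 \<le> K"
proof -
  have "is_partition 0 T {0, T}" using assms by (auto simp: is_partition_def)
  then have "psum (incr_norm \<gamma>) {0, T} 0 T \<le> K" using assms by (auto simp: variation_le_def)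
  then show ?thesis using psum_nonneg[of "incr_norm \<gamma>" "{0,T}" 0 T] by simp
qed

lemma eventually_tagged_mesh:
  assumes "0 < \<delta>"
  shows "eventually (\<lambda>(D, \<xi>). time_partition s t D \<and> mesh D \<le> \<delta> \<and>
     (\<forall>j. Suc j < length D \<longrightarrow> \<xi> j \<in> {D ! j .. D ! Suc j})) (tagged_mesh_to_0 s t)"
  unfolding tagged_mesh_to_0_def eventually_inf_principal eventually_filtercomap
  using assms eventually_nhds_in_open[of "{..<\<delta>}" 0]
  by (intro exI[of _ "\<lambda>x. x < \<delta>"]) auto

section \<open>The bracket and Riemann sums for the area\<close>

locale bounded_tensor =
  fixes tns :: "'v::banach \<Rightarrow> 'v \<Rightarrow> 'w::banach"
  assumes bilin: "bilinear tns"
    and norm_tns: "norm (tns v u) \<le> norm v * norm u"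
begin

abbreviation B where "B \<equiv> bracket tns"

lemma norm_bracket: "norm (B v u) \<le> 2 * (norm v * norm u)"
proof -
  have "norm (B v u) \<le> norm (tns v u) + norm (tns u v)"
    unfolding bracket_def by (rule norm_triangle_ineq4)
  then show ?thesis using norm_tns[of v u] norm_tns[of u v] by (simp add: mult.commute)
qed

sublocale bracket: bounded_bilinear "bracket tns"
proof
  have l: "linear (\<lambda>x. tns x y)" "linear (tns x)" for x y
    using bilin by (auto simp: bilinear_def)
  note la = linear_add[OF l(1)] linear_add[OF l(2)] linear_scale[OF l(1)] linear_scale[OF l(2)]
  show "B (a + a') b = B a b + B a' b" "B a (b + b') = B a b + B a b'"
    "B (r *\<^sub>R a) b = r *\<^sub>R B a b" "B a (r *\<^sub>R b) = r *\<^sub>R B a b" for a a' b b' r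
    by (auto simp: bracket_def la algebra_simps)
  show "\<exists>K. \<forall>a b. norm (B a b) \<le> norm a * norm b * K"
    using norm_bracket by (intro exI[of _ 2]) (auto simp: mult.commute)
qed

lemma bracket_self [simp]: "B v v = 0"
  by (simp add: bracket_def)

text \<open>Left-point Riemann sums for twice the area. The base point \<open>s\<close> is separate
  from the interval \<open>[x, y]\<close>, because Chen's relation compares sums over one interval
  with two different base points.\<close>

abbreviation left_sum where
  "left_sum \<gamma> s Z x y \<equiv> psum (\<lambda>a b. B (\<gamma> a - \<gamma> s) (\<gamma> b - \<gamma> a)) Z x y"

text \<open>A subcell starting at \<open>c\<close> lies in the same cell of \<open>X\<close> as the
  tag \<open>\<tau> a\<close>, so replacing the tag by \<open>c\<close> changes the left factor of
  the bracket by at most \<epsilon>. The factor 2 comes from \<open>norm_bracket\<close>.\<close>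

lemma riemann_sum_refine:
  assumes X: "is_partition s t X" and Z: "finite Z" "X \<subseteq> Z" and gaps: "gaps_le \<delta> X s t"
    and modu: "modulus_on s t \<delta> \<epsilon> \<gamma>"
    and tags: "\<And>a. a \<in> X \<Longrightarrow> a < t \<Longrightarrow> \<tau> a \<in> {a..nxt X a}"
  shows "norm (psum (\<lambda>a b. B (\<gamma> (\<tau> a) - \<gamma> s) (\<gamma> b - \<gamma> a)) X s t - left_sum \<gamma> s Z s t)
    \<le> 2 * \<epsilon> * psum (incr_norm \<gamma>) Z s t"
proof -
  note Xd = is_partitionD[OF X]
  let ?F = "\<lambda>a b. B (\<gamma> (\<tau> a) - \<gamma> s) (\<gamma> b - \<gamma> a)"
  let ?G = "\<lambda>a b. B (\<gamma> a - \<gamma> s) (\<gamma> b - \<gamma> a)"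
  have loc: "norm (?F a (nxt X a) - psum ?G Z a (nxt X a)) \<le> 2 * \<epsilon> * psum (incr_norm \<gamma>) Z a (nxt X a)"
    if a: "a \<in> X" "s \<le> a" "a < t" for a
  proof -
    let ?b = "nxt X a"
    note n = nxt[OF Xd(1,3) a(3)]
    \<comment> \<open>With its left factor frozen, the term is additive in its interval and so
      spreads over the subcells.\<close>
    have "psum (\<lambda>c d. B (\<gamma> (\<tau> a) - \<gamma> s) (\<gamma> d - \<gamma> c)) Z a ?b = ?F a ?b"
      using Z n a by (intro psum_additive) (auto simp: bracket.add_right[symmetric])
    then have "?F a ?b - psum ?G Z a ?b
        = psum (\<lambda>c d. B (\<gamma> (\<tau> a) - \<gamma> s) (\<gamma> d - \<gamma> c) - ?G c d) Z a ?b"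
      by (simp only: psum_diff)
    also have "\<dots> = psum (\<lambda>c d. B (\<gamma> (\<tau> a) - \<gamma> c) (\<gamma> d - \<gamma> c)) Z a ?b"
      by (simp add: bracket.diff_left[symmetric])
    also have "norm \<dots> \<le> psum (\<lambda>c d. norm (B (\<gamma> (\<tau> a) - \<gamma> c) (\<gamma> d - \<gamma> c))) Z a ?b"
      by (rule norm_psum)
    also have "\<dots> \<le> psum (\<lambda>c d. 2 * \<epsilon> * norm (\<gamma> d - \<gamma> c)) Z a ?b"
    proof (rule psum_mono)
      fix c assume c: "c \<in> Z" "a \<le> c" "c < ?b"
      have t: "\<tau> a \<in> {a..?b}" using tags a by auto
      have "?b \<le> t" "?b - a \<le> \<delta>" using n gaps a by (auto simp: gaps_le_def)
      then have "norm (\<gamma> (\<tau> a) - \<gamma> c) \<le> \<epsilon>"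
        using t c a modu unfolding modulus_on_def by auto
      then have "norm (\<gamma> (\<tau> a) - \<gamma> c) * norm (\<gamma> (nxt Z c) - \<gamma> c) \<le> \<epsilon> * norm (\<gamma> (nxt Z c) - \<gamma> c)"
        by (intro mult_right_mono) auto
      then show "norm (B (\<gamma> (\<tau> a) - \<gamma> c) (\<gamma> (nxt Z c) - \<gamma> c)) \<le> 2 * \<epsilon> * norm (\<gamma> (nxt Z c) - \<gamma> c)"
        using norm_bracket[of "\<gamma> (\<tau> a) - \<gamma> c" "\<gamma> (nxt Z c) - \<gamma> c"] by simp
    qed
    finally show ?thesis by (simp add: psum_cmult)
  qed
  have "psum ?F X s t - psum ?G Z s t = psum (\<lambda>a b. ?F a b - psum ?G Z a b) X s t"
    using psum_refine[of X Z s t ?G] Xd Z by (simp add: psum_diff)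
  then have "norm (psum ?F X s t - psum ?G Z s t) \<le> psum (\<lambda>a b. norm (?F a b - psum ?G Z a b)) X s t"
    using norm_psum[of "\<lambda>a b. ?F a b - psum ?G Z a b"] by simp
  moreover have "\<dots> \<le> psum (\<lambda>a b. 2 * \<epsilon> * psum (incr_norm \<gamma>) Z a b) X s t"
    using loc by (intro psum_mono)
  moreover have "\<dots> = 2 * \<epsilon> * psum (incr_norm \<gamma>) Z s t"
    using psum_refine[of X Z s t "incr_norm \<gamma>"] Xd Z by (simp add: psum_cmult)
  ultimately show ?thesis by linarith
qed

text \<open>In general neither partition refines the other, so both sums are compared with the left
  sum along their union; each comparison costs \<open>2 * \<epsilon> * K\<close>.\<close>

lemma tagged_sum_approx:
  assumes var: "variation_le T K \<gamma>" and st: "0 \<le> s" "s \<le> t" "t \<le> T" and "0 \<le> \<delta>" "0 \<le> \<epsilon>"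
    and modu: "modulus_on 0 T \<delta> \<epsilon> \<gamma>"
    and Z: "finite Z" "s \<in> Z" "t \<in> Z" "gaps_le \<delta> Z s t"
    and D: "time_partition s t D" "mesh D \<le> \<delta>" "\<And>j. Suc j < length D \<Longrightarrow> \<xi> j \<in> {D ! j .. D ! Suc j}"
  shows "norm ((\<Sum>j<length D - 1. B (rs_integral (*\<^sub>R) (\<lambda>_. 1) \<gamma> s (\<xi> j)) (\<gamma> (D ! Suc j) - \<gamma> (D ! j)))
     - left_sum \<gamma> s Z s t) \<le> 4 * \<epsilon> * K"
proof -
  let ?X = "set D" and ?Z = "Z \<inter> {s..t}"
  let ?Y = "?X \<union> ?Z"
  have X: "is_partition s t ?X" by (rule time_partition_set) fact
  note Xd = is_partitionD[OF X]
  note bij = time_partition_set(3)[OF D(1)] and nx = time_partition_set(2)[OF D(1)]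
  have Zp: "is_partition s t ?Z" using Z st by (auto simp: is_partition_def)
  have Ze: "left_sum \<gamma> s Z s t = left_sum \<gamma> s ?Z s t" using Z by (intro psum_cong_set) auto
  have gZ: "gaps_le \<delta> ?Z s t"
    unfolding gaps_le_def
  proof
    fix x assume x: "x \<in> ?Z \<inter> {s..<t}"
    then have "nxt ?Z x = nxt Z x" using Z by (intro nxt_cong[of _ _ t]) auto
    moreover have "nxt Z x - x \<le> \<delta>" using Z(4) x by (auto simp: gaps_le_def)
    ultimately show "nxt ?Z x - x \<le> \<delta>" by simp
  qed
  \<comment> \<open>The tags are indexed by position in the list; \<tau> indexes them by left
    endpoint, which is possible because the points of \<open>D\<close> are distinct.\<close>
  define \<tau> where "\<tau> a = \<xi> (the_inv_into {..<length D - 1} ((!) D) a)" for a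
  have \<tau>: "\<tau> (D ! j) = \<xi> j" if "j < length D - 1" for j
    using that bij by (auto simp: \<tau>_def bij_betw_def the_inv_into_f_f)
  have tags: "\<tau> a \<in> {a..nxt ?X a}" if "a \<in> ?X" "a < t" for a
  proof -
    have "a \<in> (!) D ` {..<length D - 1}" using that bij Xd by (auto simp: bij_betw_def)
    then obtain j where "a = D ! j" "j < length D - 1" by auto
    then show ?thesis using \<tau>[of j] nx[of j] D(3)[of j] by auto
  qed
  have "(\<Sum>j<length D - 1. B (rs_integral (*\<^sub>R) (\<lambda>_. 1) \<gamma> s (\<xi> j)) (\<gamma> (D ! Suc j) - \<gamma> (D ! j)))
    = (\<Sum>j<length D - 1. B (\<gamma> (\<tau> (D ! j)) - \<gamma> s) (\<gamma> (D ! Suc j) - \<gamma> (D ! j)))"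
  proof (rule sum.cong)
    fix j assume "j \<in> {..<length D - 1}"
    then have j: "j < length D - 1" and sj: "Suc j < length D" by auto
    \<comment> \<open>The limits of the inner integral must be ordered before
      \<open>rs_integral_1\<close> can evaluate it.\<close>
    have "s \<le> D ! j" using Xd(5)[of "D ! j"] sj by auto
    also have "\<dots> \<le> \<xi> j" using D(3)[OF sj] by auto
    finally have "s \<le> \<xi> j" .
    then show "B (rs_integral (*\<^sub>R) (\<lambda>_. 1) \<gamma> s (\<xi> j)) (\<gamma> (D ! Suc j) - \<gamma> (D ! j))
      = B (\<gamma> (\<tau> (D ! j)) - \<gamma> s) (\<gamma> (D ! Suc j) - \<gamma> (D ! j))"
      using \<tau>[OF j] by (simp add: rs_integral_1)
  qed simp
  also have "\<dots> = psum (\<lambda>a b. B (\<gamma> (\<tau> a) - \<gamma> s) (\<gamma> b - \<gamma> a)) ?X s t"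
    by (rule time_partition_sum) fact
  finally have R: "(\<Sum>j<length D - 1. B (rs_integral (*\<^sub>R) (\<lambda>_. 1) \<gamma> s (\<xi> j)) (\<gamma> (D ! Suc j) - \<gamma> (D ! j)))
    = psum (\<lambda>a b. B (\<gamma> (\<tau> a) - \<gamma> s) (\<gamma> b - \<gamma> a)) ?X s t" (is "?R = _") .
  have modu': "modulus_on s t \<delta> \<epsilon> \<gamma>" using modulus_on_subinterval[OF modu] st by auto
  have fY: "finite ?Y" using Xd Z by auto
  have "gaps_le \<delta> ?X s t" using D mesh_le_iff[OF D(1)] \<open>0 \<le> \<delta>\<close> by auto
  then have 1: "norm (?R - left_sum \<gamma> s ?Y s t) \<le> 2 * \<epsilon> * psum (incr_norm \<gamma>) ?Y s t"
    unfolding R using fY tags by (intro riemann_sum_refine[OF X _ _ _ modu']) auto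
  have 2: "norm (left_sum \<gamma> s ?Z s t - left_sum \<gamma> s ?Y s t) \<le> 2 * \<epsilon> * psum (incr_norm \<gamma>) ?Y s t"
  proof (rule riemann_sum_refine[OF Zp _ _ gZ modu', where \<tau> = "\<lambda>a. a"])
    fix a assume "a \<in> ?Z" "a < t"
    then show "a \<in> {a..nxt ?Z a}" using nxt(2)[of ?Z t a] is_partitionD(1,3)[OF Zp] by auto
  qed (use fY in auto)
  have "psum (incr_norm \<gamma>) ?Y s t \<le> K"
    using Xd st fY by (intro variation_le_psum[OF var]) auto
  then have "2 * \<epsilon> * psum (incr_norm \<gamma>) ?Y s t \<le> 2 * \<epsilon> * K" using \<open>0 \<le> \<epsilon>\<close> by (intro mult_left_mono) auto
  then have "norm (?R - left_sum \<gamma> s ?Z s t) \<le> 2 * \<epsilon> * K + 2 * \<epsilon> * K"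
    using 1 2 by (intro norm_diff_triangle_le[of ?R "left_sum \<gamma> s ?Y s t"]) (auto simp: norm_minus_commute)
  then show ?thesis by (simp add: Ze mult.commute mult.left_commute)
qed

text \<open>\<open>Lim\<close> is informative once the limit is known to exist. The Riemann sums are
  eventually within \<open>4 * \<epsilon> * K\<close> of one fixed left sum, so they are Cauchy and
  converge by completeness; the bound survives in the limit.\<close>

lemma area_approx:
  assumes cont: "continuous_on {0..T} \<gamma>" and var: "variation_le T K \<gamma>"
    and st: "0 \<le> s" "s \<le> t" "t \<le> T" and "0 < \<delta>" "0 \<le> \<epsilon>"
    and modu: "modulus_on 0 T \<delta> \<epsilon> \<gamma>"
    and Z: "finite Z" "s \<in> Z" "t \<in> Z" "gaps_le \<delta> Z s t"
  shows "norm (2 *\<^sub>R area tns \<gamma> (s, t) - left_sum \<gamma> s Z s t) \<le> 4 * \<epsilon> * K"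
proof -
  define R where "R = (\<lambda>(D, \<xi>). \<Sum>j<length D - 1.
     B (rs_integral (*\<^sub>R) (\<lambda>_. 1) \<gamma> s (\<xi> j)) (\<gamma> (D ! Suc j) - \<gamma> (D ! j)))"
  let ?F = "tagged_mesh_to_0 s t"
  have K: "0 \<le> K" using variation_le_nonneg[OF var] st by simp
  have ev: "eventually (\<lambda>x. norm (R x - left_sum \<gamma> s Z s t) \<le> 4 * \<epsilon> * K) ?F"
    if "0 < \<delta>" "0 \<le> \<epsilon>" "modulus_on 0 T \<delta> \<epsilon> \<gamma>" "finite Z" "s \<in> Z" "t \<in> Z" "gaps_le \<delta> Z s t"
    for \<delta> \<epsilon> Z
    using eventually_tagged_mesh[OF that(1)]
  proof eventually_elim
    case (elim x)
    obtain D \<xi> where x: "x = (D, \<xi>)" by (cases x)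
    show ?case using elim tagged_sum_approx[OF var st _ that(2-7), of D \<xi>] that(1)
      by (simp add: x R_def)
  qed
  have "cauchy_filter (filtermap R ?F)"
    unfolding cauchy_filter_metric_filtermap
  proof (intro allI impI)
    fix e :: real assume "0 < e"
    \<comment> \<open>Two Riemann sums differ by at most \<open>8 * \<epsilon> * K\<close>, which is
      then below \<open>e\<close>; the \<open>+ 1\<close> covers \<open>K = 0\<close>.\<close>
    define \<epsilon> where "\<epsilon> = e / (16 * (K + 1))"
    have e: "0 < \<epsilon>" using \<open>0 < e\<close> K by (simp add: \<epsilon>_def)
    have "8 * (\<epsilon> * K) \<le> 8 * (\<epsilon> * (K + 1))" using e K by (intro mult_left_mono) auto
    also have "\<dots> = e / 2" using K by (simp add: \<epsilon>_def field_simps)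
    finally have ee: "8 * (\<epsilon> * K) < e" using \<open>0 < e\<close> by simp
    obtain \<delta> where \<delta>: "0 < \<delta>" "modulus_on 0 T \<delta> \<epsilon> \<gamma>" using ex_modulus[OF cont e] by blast
    obtain Z where Z: "is_partition s t Z" "gaps_le \<delta> Z s t"
      using ex_fine_partition[OF st(2) \<delta>(1), of "{}"] by auto
    note Zd = is_partitionD[OF Z(1)]
    let ?P = "\<lambda>x. norm (R x - left_sum \<gamma> s Z s t) \<le> 4 * \<epsilon> * K"
    have "eventually ?P ?F" using e by (intro ev[OF \<delta>(1) _ \<delta>(2) Zd(1-3) Z(2)]) auto
    moreover have "dist (R x) (R y) < e" if "?P x" "?P y" for x y
    proof -
      have "dist (R x) (R y) \<le> norm (R x - left_sum \<gamma> s Z s t) + norm (R y - left_sum \<gamma> s Z s t)"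
        using dist_triangle2[of "R x" "R y" "left_sum \<gamma> s Z s t"] by (simp add: dist_norm)
      then show ?thesis using that ee by simp
    qed
    ultimately show "\<exists>P. eventually P ?F \<and> (\<forall>x y. P x \<and> P y \<longrightarrow> dist (R x) (R y) < e)"
      by (intro exI[of _ ?P]) auto
  qed
  moreover have nb: "?F \<noteq> bot" by (rule tagged_mesh_to_0_neq_bot) fact
  ultimately obtain I where "filtermap R ?F \<le> nhds I"
    using cauchy_filter_complete_converges[of "filtermap R ?F" UNIV] by (auto simp: complete_UNIV filtermap_bot_iff)
  then have I: "(R \<longlongrightarrow> I) ?F" by (simp add: filterlim_def)
  have "area tns \<gamma> (s, t) = (1/2) *\<^sub>R I"
    unfolding area_def rs_integral_def[of B] using tendsto_Lim[OF nb I] by (simp add: R_def)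
  moreover have "norm (I - left_sum \<gamma> s Z s t) \<le> 4 * \<epsilon> * K"
    by (rule tendsto_upperbound[OF tendsto_norm[OF tendsto_diff[OF I tendsto_const]] ev nb]) fact+
  ultimately show ?thesis by simp
qed

text \<open>One \<delta> and one error serve all subintervals and all fine \<open>Z\<close>, so
  areas over different intervals can be compared along a single partition.\<close>

definition area_approximable where
  "area_approximable T \<delta> \<eta> \<gamma> \<longleftrightarrow> (\<forall>s t Z. 0 \<le> s \<longrightarrow> s \<le> t \<longrightarrow> t \<le> T \<longrightarrow> finite Z \<longrightarrow> s \<in> Z \<longrightarrow> t \<in> Z \<longrightarrow>
     gaps_le \<delta> Z s t \<longrightarrow> norm (2 *\<^sub>R area tns \<gamma> (s, t) - left_sum \<gamma> s Z s t) \<le> \<eta>)"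

lemma area_approximableD:
  assumes "area_approximable T \<delta> \<eta> \<gamma>" "0 \<le> s" "s \<le> t" "t \<le> T" "finite Z" "s \<in> Z" "t \<in> Z" "gaps_le \<delta> Z s t"
  shows "norm (2 *\<^sub>R area tns \<gamma> (s, t) - left_sum \<gamma> s Z s t) \<le> \<eta>"
  using assms unfolding area_approximable_def by blast

lemma area_approx_uniform:
  assumes cont: "continuous_on {0..T} \<gamma>" and var: "variation_le T K \<gamma>" and "0 \<le> T" "0 < \<eta>"
  obtains \<delta> where "0 < \<delta>" "area_approximable T \<delta> \<eta> \<gamma>"
proof -
  have K: "0 \<le> K" using variation_le_nonneg[OF var] assms by simp
  define \<epsilon> where "\<epsilon> = \<eta> / (4 * (K + 1))"
  have e: "0 < \<epsilon>" using assms K by (simp add: \<epsilon>_def)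
  have "4 * \<epsilon> * K \<le> 4 * \<epsilon> * (K + 1)" using e by (intro mult_left_mono) auto
  also have "\<dots> = \<eta>" using K by (simp add: \<epsilon>_def field_simps)
  finally have ee: "4 * \<epsilon> * K \<le> \<eta>" .
  obtain \<delta> where \<delta>: "0 < \<delta>" "modulus_on 0 T \<delta> \<epsilon> \<gamma>" using ex_modulus[OF cont e] by blast
  have "area_approximable T \<delta> \<eta> \<gamma>"
    unfolding area_approximable_def
    using order_trans[OF area_approx[OF cont var _ _ _ \<delta>(1) _ \<delta>(2)] ee] e by auto
  then show thesis by (rule that[OF \<delta>(1)])
qed

section \<open>Chen's relation, linear pieces and vanishing 1-variation of the area\<close>

lemma area_chen:
  assumes cont: "continuous_on {0..T} \<gamma>" and var: "variation_le T K \<gamma>"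
    and st: "0 \<le> s" "s \<le> u" "u \<le> t" "t \<le> T"
  shows "area tns \<gamma> (s, t) = area tns \<gamma> (s, u) + area tns \<gamma> (u, t) + (1/2) *\<^sub>R B (\<gamma> u - \<gamma> s) (\<gamma> t - \<gamma> u)"
proof -
  let ?E = "2 *\<^sub>R area tns \<gamma> (s, t) - (2 *\<^sub>R area tns \<gamma> (s, u) + 2 *\<^sub>R area tns \<gamma> (u, t) + B (\<gamma> u - \<gamma> s) (\<gamma> t - \<gamma> u))"
  have T: "0 \<le> T" using st by simp
  have "norm ?E \<le> 0 + e" if e: "0 < e" for e
  proof -
    obtain \<delta> where \<delta>: "0 < \<delta>" "area_approximable T \<delta> (e/3) \<gamma>"
      using area_approx_uniform[OF cont var T, of "e/3"] e by auto
    obtain Z where Z: "is_partition 0 T Z" "gaps_le \<delta> Z 0 T" "{s,u,t} \<subseteq> Z"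
      using ex_fine_partition[OF T \<delta>(1), of "{s,u,t}"] st by auto
    note Zd = is_partitionD[OF Z(1)]
    \<comment> \<open>Moving the base point from \<open>s\<close> to \<open>u\<close> changes the
      left sum by a telescoping sum, which is the bracket term. So Chen's relation is exact for left
      sums along a common partition, and the error comes from three approximations of areas.\<close>
    have "left_sum \<gamma> s Z u t - left_sum \<gamma> u Z u t = psum (\<lambda>a b. B (\<gamma> u - \<gamma> s) (\<gamma> b - \<gamma> a)) Z u t"
      by (simp add: psum_diff[symmetric] bracket.diff_left[symmetric])
    also have "\<dots> = B (\<gamma> u - \<gamma> s) (\<gamma> t - \<gamma> u)"
      using Zd Z st by (intro psum_additive) (auto simp: bracket.add_right[symmetric])
    finally have L: "left_sum \<gamma> s Z s t = left_sum \<gamma> s Z s u + (left_sum \<gamma> u Z u t + B (\<gamma> u - \<gamma> s) (\<gamma> t - \<gamma> u))"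
      using psum_split[OF Zd(1) st(2,3), of "\<lambda>a b. B (\<gamma> a - \<gamma> s) (\<gamma> b - \<gamma> a)"]
      by (simp add: algebra_simps)
    have g: "gaps_le \<delta> Z x y" if "0 \<le> x" "y \<le> T" for x y using gaps_le_subinterval[OF Z(2) that] .
    define P Q R where "P = 2 *\<^sub>R area tns \<gamma> (s, t) - left_sum \<gamma> s Z s t"
      and "Q = 2 *\<^sub>R area tns \<gamma> (s, u) - left_sum \<gamma> s Z s u"
      and "R = 2 *\<^sub>R area tns \<gamma> (u, t) - left_sum \<gamma> u Z u t"
    have "norm P \<le> e/3" "norm Q \<le> e/3" "norm R \<le> e/3"
      unfolding P_def Q_def R_def
      by (rule area_approximableD[OF \<delta>(2)]; use st Z Zd(1) in \<open>auto intro!: g\<close>)+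
    moreover have "?E = P - (Q + R)" unfolding P_def Q_def R_def L by (simp add: algebra_simps)
    ultimately show ?thesis
      using norm_triangle_ineq4[of P "Q + R"] norm_triangle_ineq[of Q R] by simp
  qed
  then have "norm ?E \<le> 0" by (rule field_le_epsilon)
  then have "2 *\<^sub>R area tns \<gamma> (s, t) = 2 *\<^sub>R (area tns \<gamma> (s, u) + area tns \<gamma> (u, t) + (1/2) *\<^sub>R B (\<gamma> u - \<gamma> s) (\<gamma> t - \<gamma> u))"
    by (simp add: scaleR_add_right)
  then show ?thesis by (simp only: scaleR_cancel_left) simp
qed

text \<open>The increments on the segment are parallel and the bracket is alternating, so every left
  sum is zero.\<close>

lemma area_linear_segment:
  assumes cont: "continuous_on {0..T} \<gamma>" and var: "variation_le T K \<gamma>"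
    and st: "0 \<le> s" "s \<le> t" "t \<le> T"
    and lin: "\<And>u v. u \<in> {s..t} \<Longrightarrow> v \<in> {s..t} \<Longrightarrow> \<gamma> v - \<gamma> u = (v - u) *\<^sub>R d"
  shows "area tns \<gamma> (s, t) = 0"
proof -
  have T: "0 \<le> T" using st by simp
  have "norm (2 *\<^sub>R area tns \<gamma> (s, t)) \<le> 0 + e" if e: "0 < e" for e
  proof -
    obtain \<delta> where \<delta>: "0 < \<delta>" "area_approximable T \<delta> (e) \<gamma>"
      using area_approx_uniform[OF cont var T e] .
    obtain Z where Z: "is_partition s t Z" "gaps_le \<delta> Z s t"
      using ex_fine_partition[OF st(2) \<delta>(1), of "{}"] by auto
    note Zd = is_partitionD[OF Z(1)]
    have "left_sum \<gamma> s Z s t = psum (\<lambda>a b. 0) Z s t"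
    proof (rule psum_cong)
      fix a assume a: "a \<in> Z" "s \<le> a" "a < t"
      note n = nxt[OF Zd(1,3) a(3)]
      show "B (\<gamma> a - \<gamma> s) (\<gamma> (nxt Z a) - \<gamma> a) = 0"
        using lin[of s a] lin[of a "nxt Z a"] n a by (simp add: bracket.scaleR_left bracket.scaleR_right)
    qed (use Zd in auto)
    then have "left_sum \<gamma> s Z s t = 0" by (simp add: psum_def)
    then show ?thesis using area_approximableD[OF \<delta>(2) st Zd(1-3) Z(2)] by simp
  qed
  then have "norm (2 *\<^sub>R area tns \<gamma> (s, t)) \<le> 0" by (rule field_le_epsilon)
  then show ?thesis by simp
qed

text \<open>On a cell shorter than \<delta> the left factor \<open>\<gamma> c - \<gamma> a\<close>
  has norm at most \<epsilon>, so the area is at most \<epsilon> times the variation of \<gamma> on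
  that cell. These bounds add up to \<open>\<epsilon> * K\<close>.\<close>

lemma area_vanishing_1var:
  assumes cont: "continuous_on {0..T} \<gamma>" and var: "variation_le T K \<gamma>" and "0 \<le> T" "0 < \<eta>"
  obtains \<delta> where "0 < \<delta>"
    "\<And>X. is_partition 0 T X \<Longrightarrow> gaps_le \<delta> X 0 T \<Longrightarrow> psum (\<lambda>a b. norm (area tns \<gamma> (a, b))) X 0 T \<le> \<eta>"
proof -
  have K: "0 \<le> K" using variation_le_nonneg[OF var] assms by simp
  define \<epsilon> where "\<epsilon> = \<eta> / (K + 1)"
  have e: "0 < \<epsilon>" using assms K by (simp add: \<epsilon>_def)
  have "\<epsilon> * K \<le> \<epsilon> * (K + 1)" using e by (intro mult_left_mono) auto
  also have "\<dots> = \<eta>" using K by (simp add: \<epsilon>_def field_simps)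
  finally have ee: "\<epsilon> * K \<le> \<eta>" .
  obtain \<delta> where \<delta>: "0 < \<delta>" "modulus_on 0 T \<delta> \<epsilon> \<gamma>" using ex_modulus[OF cont e] by blast
  have "psum (\<lambda>a b. norm (area tns \<gamma> (a, b))) X 0 T \<le> \<eta>" if X: "is_partition 0 T X" "gaps_le \<delta> X 0 T" for X
  proof (rule field_le_epsilon)
    fix r :: real assume "0 < r"
    note Xd = is_partitionD[OF X(1)]
    \<comment> \<open>The error \<open>r\<close> of replacing areas by left sums is shared among at
      most \<open>card X\<close> cells. It is arbitrary and \<delta> was fixed before it, so it
      disappears at the end.\<close>
    define \<rho> where "\<rho> = r / real (card X)"
    have c: "card X > 0" using Xd by (auto simp: card_gt_0_iff)
    then have "0 < \<rho>" using \<open>0 < r\<close> by (simp add: \<rho>_def)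
    then obtain d where d: "0 < d" "area_approximable T d \<rho> \<gamma>"
      using area_approx_uniform[OF cont var \<open>0 \<le> T\<close>] by metis
    obtain Z where Z: "is_partition 0 T Z" "gaps_le d Z 0 T" "X \<subseteq> Z"
      using ex_fine_partition[OF \<open>0 \<le> T\<close> d(1), of X] X(1) by (auto simp: is_partition_def)
    note Zd = is_partitionD[OF Z(1)]
    have "psum (\<lambda>a b. norm (area tns \<gamma> (a, b))) X 0 T \<le> psum (\<lambda>a b. \<rho> + \<epsilon> * psum (incr_norm \<gamma>) Z a b) X 0 T"
    proof (rule psum_mono)
      fix a assume a: "a \<in> X" "0 \<le> a" "a < T"
      let ?b = "nxt X a"
      note n = nxt[OF Xd(1,3) a(3)]
      have "norm (left_sum \<gamma> a Z a ?b) \<le> psum (\<lambda>c d. norm (B (\<gamma> c - \<gamma> a) (\<gamma> d - \<gamma> c))) Z a ?b"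
        by (rule norm_psum)
      also have "\<dots> \<le> psum (\<lambda>c d. 2 * \<epsilon> * norm (\<gamma> d - \<gamma> c)) Z a ?b"
      proof (rule psum_mono)
        fix c assume c: "c \<in> Z" "a \<le> c" "c < ?b"
        have "?b - a \<le> \<delta>" using X a by (auto simp: gaps_le_def)
        then have "norm (\<gamma> c - \<gamma> a) \<le> \<epsilon>" using \<delta>(2) c a n unfolding modulus_on_def by auto
        then have "norm (\<gamma> c - \<gamma> a) * norm (\<gamma> (nxt Z c) - \<gamma> c) \<le> \<epsilon> * norm (\<gamma> (nxt Z c) - \<gamma> c)"
          by (intro mult_right_mono) auto
        then show "norm (B (\<gamma> c - \<gamma> a) (\<gamma> (nxt Z c) - \<gamma> c)) \<le> 2 * \<epsilon> * norm (\<gamma> (nxt Z c) - \<gamma> c)"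
          using norm_bracket[of "\<gamma> c - \<gamma> a" "\<gamma> (nxt Z c) - \<gamma> c"] by simp
      qed
      finally have 1: "norm (left_sum \<gamma> a Z a ?b) \<le> 2 * \<epsilon> * psum (incr_norm \<gamma>) Z a ?b"
        by (simp add: psum_cmult)
      have 2: "norm (2 *\<^sub>R area tns \<gamma> (a, ?b) - left_sum \<gamma> a Z a ?b) \<le> \<rho>"
        using n a Zd Z gaps_le_subinterval[OF Z(2)] by (intro area_approximableD[OF d(2)]) auto
      have "2 * norm (area tns \<gamma> (a, ?b)) \<le> \<rho> + 2 * \<epsilon> * psum (incr_norm \<gamma>) Z a ?b"
        using 1 2 norm_triangle_sub[of "2 *\<^sub>R area tns \<gamma> (a, ?b)" "left_sum \<gamma> a Z a ?b"] by simp
      then show "norm (area tns \<gamma> (a, ?b)) \<le> \<rho> + \<epsilon> * psum (incr_norm \<gamma>) Z a ?b"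
        using \<open>0 < \<rho>\<close> by simp
    qed
    also have "\<dots> = psum (\<lambda>a b. \<rho>) X 0 T + \<epsilon> * psum (incr_norm \<gamma>) Z 0 T"
      using psum_refine[of X Z 0 T "incr_norm \<gamma>"] Xd Zd Z by (simp add: psum_add psum_cmult)
    also have "psum (\<lambda>a b. \<rho>) X 0 T \<le> card X * \<rho>"
      using \<open>0 < \<rho>\<close> Xd(1) by (auto simp: psum_def intro!: card_mono mult_right_mono)
    also have "card X * \<rho> = r" using c by (simp add: \<rho>_def)
    also have "\<epsilon> * psum (incr_norm \<gamma>) Z 0 T \<le> \<epsilon> * K"
      using e Z var by (intro mult_left_mono) (auto simp: variation_le_def)
    finally show "psum (\<lambda>a b. norm (area tns \<gamma> (a, b))) X 0 T \<le> \<eta> + r" using ee by simp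
  qed
  then show thesis by (rule that[OF \<delta>(1)])
qed

end

section \<open>Bounds on variations as bounds on sums\<close>

lemma ennreal_powr_le_iff:
  assumes "0 \<le> e" "0 < q"
  shows "ennreal_powr x q \<le> ennreal e \<longleftrightarrow> x \<le> ennreal (e powr (1 / q))"
proof (cases x)
  case (real r)
  have "r powr q \<le> e \<longleftrightarrow> r \<le> e powr (1 / q)"
  proof
    assume "r powr q \<le> e"
    then have "(r powr q) powr (1 / q) \<le> e powr (1 / q)" using assms by (intro powr_mono2) auto
    then show "r \<le> e powr (1 / q)" using assms real by (simp add: powr_powr)
  next
    assume "r \<le> e powr (1 / q)"
    then have "r powr q \<le> (e powr (1 / q)) powr q" using assms real by (intro powr_mono2) auto
    then show "r powr q \<le> e" using assms by (simp add: powr_powr)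
  qed
  then show ?thesis using real assms by (simp add: ennreal_powr_def)
next
  case top
  then show ?thesis by (simp add: ennreal_powr_def top_unique)
qed

lemma var_sum_psum:
  assumes "time_partition s t D"
  shows "var_sum p \<alpha> D = psum (\<lambda>a b. norm (\<alpha> (a, b)) powr p) (set D) s t"
  unfolding var_sum_def by (rule time_partition_sum[OF assms])

lemma SUP_var_sum_le_iff:
  assumes "0 \<le> c"
  shows "(SUP D\<in>{D. time_partition 0 T D}. ennreal (var_sum p \<alpha> D)) \<le> ennreal c
      \<longleftrightarrow> (\<forall>X. is_partition 0 T X \<longrightarrow> psum (\<lambda>a b. norm (\<alpha> (a, b)) powr p) X 0 T \<le> c)"
  using time_partition_set(1)[of 0 T] time_partition_sorted_list_of_set[of 0 T] is_partitionD(1)[of 0 T] assms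
  by (simp add: SUP_le_iff) (metis var_sum_psum set_sorted_list_of_set)

lemma SUP_mesh_var_sum_le_iff:
  assumes "0 \<le> c" "0 \<le> \<delta>"
  shows "(SUP D\<in>{D. time_partition 0 T D \<and> mesh D \<le> \<delta>}. ennreal (var_sum p \<alpha> D)) \<le> ennreal c
      \<longleftrightarrow> (\<forall>X. is_partition 0 T X \<and> gaps_le \<delta> X 0 T \<longrightarrow> psum (\<lambda>a b. norm (\<alpha> (a, b)) powr p) X 0 T \<le> c)"
  using time_partition_set(1)[of 0 T] time_partition_sorted_list_of_set[of 0 T] is_partitionD(1)[of 0 T] assms(1)
    mesh_le_iff[OF _ assms(2), of 0 T]
  by (simp add: SUP_le_iff) (metis var_sum_psum set_sorted_list_of_set)

lemma pvar_le_iff: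
  assumes "0 \<le> e" "0 < p"
  shows "pvar p T \<alpha> \<le> ennreal e
    \<longleftrightarrow> (\<forall>X. is_partition 0 T X \<longrightarrow> psum (\<lambda>a b. norm (\<alpha> (a, b)) powr p) X 0 T \<le> e powr p)"
  using assms unfolding pvar_def by (subst ennreal_powr_le_iff) (auto simp: SUP_var_sum_le_iff)

lemma pvar_modulus_le_iff:
  assumes "0 \<le> e" "0 < p" "0 \<le> \<delta>"
  shows "pvar_modulus p T \<alpha> \<delta> \<le> ennreal e
    \<longleftrightarrow> (\<forall>X. is_partition 0 T X \<and> gaps_le \<delta> X 0 T \<longrightarrow> psum (\<lambda>a b. norm (\<alpha> (a, b)) powr p) X 0 T \<le> e powr p)"
  using assms unfolding pvar_modulus_def by (subst ennreal_powr_le_iff) (auto simp: SUP_mesh_var_sum_le_iff)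

section \<open>Convergence to zero in epsilon-delta form\<close>

lemma tendsto_0_ennreal_iff:
  fixes f :: "'a \<Rightarrow> ennreal"
  shows "(f \<longlongrightarrow> 0) F \<longleftrightarrow> (\<forall>e>0. eventually (\<lambda>x. f x \<le> ennreal e) F)"
proof
  assume f: "(f \<longlongrightarrow> 0) F"
  show "\<forall>e>0. eventually (\<lambda>x. f x \<le> ennreal e) F"
  proof (intro allI impI)
    fix e :: real assume "0 < e"
    then have "eventually (\<lambda>x. f x < ennreal e) F" by (intro order_tendstoD(2)[OF f]) simp
    then show "eventually (\<lambda>x. f x \<le> ennreal e) F" by (rule eventually_mono) simp
  qed
next
  assume e: "\<forall>e>0. eventually (\<lambda>x. f x \<le> ennreal e) F"
  show "(f \<longlongrightarrow> 0) F"
  proof (rule order_tendstoI)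
    fix a :: ennreal assume "0 < a"
    then obtain y where y: "0 < y" "y < a" using dense by blast
    then obtain r where "y = ennreal r" "0 < r" by (cases y) auto
    then have "eventually (\<lambda>x. f x \<le> y) F" using e by auto
    then show "eventually (\<lambda>x. f x < a) F" by (rule eventually_mono) (use y in auto)
  qed simp
qed

lemma eventually_mesh_to_0:
  "eventually P (mesh_to_0 T) \<longleftrightarrow> (\<exists>\<delta>>0. \<forall>D. time_partition 0 T D \<longrightarrow> mesh D \<le> \<delta> \<longrightarrow> P D)"
proof
  assume "eventually P (mesh_to_0 T)"
  then obtain Q where Q: "eventually Q (nhds (0::real))" "\<And>D. Q (mesh D) \<Longrightarrow> time_partition 0 T D \<Longrightarrow> P D"
    unfolding mesh_to_0_def eventually_inf_principal eventually_filtercomap by auto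
  then obtain d where d: "d > 0" "\<And>x. \<bar>x\<bar> < d \<Longrightarrow> Q x"
    unfolding eventually_nhds_metric by (auto simp: dist_real_def)
  \<comment> \<open>Since \<open>mesh\<close> is nonnegative, the bound \<open>d / 2\<close> gives a
    strict bound on its absolute value.\<close>
  have "P D" if "time_partition 0 T D" "mesh D \<le> d / 2" for D
    using that d mesh_nonneg[of D] by (intro Q(2) d(2)) auto
  then show "\<exists>\<delta>>0. \<forall>D. time_partition 0 T D \<longrightarrow> mesh D \<le> \<delta> \<longrightarrow> P D"
    using d by (intro exI[of _ "d/2"]) auto
next
  assume "\<exists>\<delta>>0. \<forall>D. time_partition 0 T D \<longrightarrow> mesh D \<le> \<delta> \<longrightarrow> P D"
  then obtain \<delta> where "\<delta> > 0" "\<And>D. time_partition 0 T D \<Longrightarrow> mesh D \<le> \<delta> \<Longrightarrow> P D" by blast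
  then show "eventually P (mesh_to_0 T)"
    unfolding mesh_to_0_def eventually_inf_principal eventually_filtercomap
    using eventually_nhds_in_open[of "{..<\<delta>}" 0]
    by (intro exI[of _ "\<lambda>x. x < \<delta>"]) auto
qed

section \<open>Quadratic sums and the rough path distance\<close>

abbreviation incr_sq :: "(real \<Rightarrow> 'v::real_normed_vector) \<Rightarrow> real \<Rightarrow> real \<Rightarrow> real" where
  "incr_sq \<gamma> \<equiv> \<lambda>a b. (norm (\<gamma> b - \<gamma> a))\<^sup>2"

lemma pvar_2_increments_le_iff:
  assumes "0 \<le> e"
  shows "pvar 2 T (increments \<gamma>) \<le> ennreal e
    \<longleftrightarrow> (\<forall>X. is_partition 0 T X \<longrightarrow> psum (incr_sq \<gamma>) X 0 T \<le> e\<^sup>2)"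
  using assms by (simp add: pvar_le_iff increments_def)

lemma pvar_1_le_iff:
  assumes "0 \<le> e"
  shows "pvar 1 T \<alpha> \<le> ennreal e
    \<longleftrightarrow> (\<forall>X. is_partition 0 T X \<longrightarrow> psum (\<lambda>a b. norm (\<alpha> (a, b))) X 0 T \<le> e)"
  using assms by (simp add: pvar_le_iff)

lemma C_pvar_1_iff:
  assumes "0 \<le> T"
  shows "\<gamma> \<in> C_pvar 1 T \<longleftrightarrow> continuous_on {0..T} \<gamma> \<and> (\<exists>K. variation_le T K \<gamma>)"
proof -
  have "pvar 1 T (increments \<gamma>) < \<infinity> \<longleftrightarrow> (\<exists>K\<ge>0. pvar 1 T (increments \<gamma>) \<le> ennreal K)"
    by (cases "pvar 1 T (increments \<gamma>)") (auto simp: top_unique)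
  also have "\<dots> \<longleftrightarrow> (\<exists>K\<ge>0. variation_le T K \<gamma>)"
    using pvar_1_le_iff[of _ T "increments \<gamma>"] by (auto simp: variation_le_def increments_def)
  also have "\<dots> \<longleftrightarrow> (\<exists>K. variation_le T K \<gamma>)"
    using variation_le_nonneg[OF _ assms] by blast
  finally show ?thesis by (simp add: C_pvar_def)
qed

lemma C0_pvar_2_modulus:
  assumes "\<gamma> \<in> C0_pvar 2 T" "0 < \<epsilon>"
  obtains \<delta> where "0 < \<delta>"
    "\<forall>X. is_partition 0 T X \<and> gaps_le \<delta> X 0 T \<longrightarrow> psum (incr_sq \<gamma>) X 0 T \<le> \<epsilon>"
proof -
  have "(pvar_modulus 2 T (increments \<gamma>) \<longlongrightarrow> 0) (at_right 0)"
    using assms by (simp add: C0_pvar_def vanishing_pvar_def)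
  \<comment> \<open>The modulus is the square root of a supremum of quadratic sums, hence
    \<open>sqrt \<epsilon>\<close>.\<close>
  then have "eventually (\<lambda>\<delta>. pvar_modulus 2 T (increments \<gamma>) \<delta> \<le> ennreal (sqrt \<epsilon>)) (at_right 0)"
    using assms(2) by (simp add: tendsto_0_ennreal_iff)
  then obtain b where b: "b > 0" "\<And>\<delta>. 0 < \<delta> \<Longrightarrow> \<delta> < b \<Longrightarrow> pvar_modulus 2 T (increments \<gamma>) \<delta> \<le> ennreal (sqrt \<epsilon>)"
    unfolding eventually_at_right_field by auto
  have "pvar_modulus 2 T (increments \<gamma>) (b/2) \<le> ennreal (sqrt \<epsilon>)" using b by simp
  then show thesis
    using that[of "b/2"] b(1) assms(2) by (simp add: pvar_modulus_le_iff increments_def)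
qed

text \<open>The 2-variation enters squared and the area part linearly, so the tolerance for the area
  that matches \<open>e\<close> is \<open>e\<^sup>2\<close>.\<close>

lemma rough_distance_le:
  assumes "0 \<le> e" "P \<le> ennreal e" "Q \<le> ennreal (e\<^sup>2)"
  shows "ennreal_powr (P\<^sup>2 + Q) (1/2) \<le> ennreal (2 * e)"
proof -
  have "P\<^sup>2 \<le> (ennreal e)\<^sup>2" using assms(2) by (intro power_mono) auto
  then have "P\<^sup>2 + Q \<le> ennreal (e\<^sup>2) + ennreal (e\<^sup>2)"
    using assms by (intro add_mono) (auto simp: ennreal_power)
  also have "\<dots> \<le> ennreal ((2 * e) powr 2)" using assms(1) by (simp flip: ennreal_plus)
  finally show ?thesis using assms(1) by (simp add: ennreal_powr_le_iff)
qed

lemma rough_distance_leD: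
  assumes "0 \<le> e" "ennreal_powr (P\<^sup>2 + Q) (1/2) \<le> ennreal e"
  shows "P \<le> ennreal e" "Q \<le> ennreal (e\<^sup>2)"
proof -
  have le: "P\<^sup>2 + Q \<le> ennreal (e\<^sup>2)" using assms by (simp add: ennreal_powr_le_iff)
  show "Q \<le> ennreal (e\<^sup>2)" by (rule order_trans[OF _ le]) (simp add: add_increasing)
  have "P\<^sup>2 \<le> ennreal (e\<^sup>2)" by (rule order_trans[OF _ le]) (simp add: add_increasing2)
  then show "P \<le> ennreal e"
    using assms(1) by (cases P) (auto simp: ennreal_power power2_le_iff_abs_le top_unique)
qed

section \<open>Piecewise linear interpolations\<close>

lemma power2_norm_triangle: "(norm (x + y))\<^sup>2 \<le> 2 * (norm x)\<^sup>2 + 2 * (norm y)\<^sup>2"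
proof -
  have "(norm (x + y))\<^sup>2 \<le> (norm x + norm y)\<^sup>2" by (intro power_mono norm_triangle_ineq) auto
  also have "\<dots> \<le> 2 * (norm x)\<^sup>2 + 2 * (norm y)\<^sup>2"
    using sum_squares_bound[of "norm x" "norm y"] by (simp add: power2_sum)
  finally show ?thesis .
qed

section \<open>Increments of an interpolation\<close>

lemma pl_interp_node:
  assumes "sorted_wrt (<) D" "x \<in> set D"
  shows "pl_interp \<gamma> D x = \<gamma> x"
  using assms
proof (induction \<gamma> D x rule: pl_interp.induct)
  case (1 \<gamma> a b D u)
  show ?case
  proof (cases "u \<le> b")
    case True
    then have "u = a \<or> u = b" using 1 by auto
    then show ?thesis using 1(2) by (auto simp: linepath_def)
  next
    case False
    then have "u \<in> set (b # D)" using 1 by auto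
    then show ?thesis using 1 False by simp
  qed
qed auto

context
  fixes D and s t :: real
  assumes D: "time_partition s t D"
begin

lemma pl_interp_diff:
  assumes "a \<in> set D" "a < t" "u \<in> {a..nxt (set D) a}" "v \<in> {a..nxt (set D) a}"
  shows "pl_interp \<gamma> D v - pl_interp \<gamma> D u = ((v - u) / (nxt (set D) a - a)) *\<^sub>R (\<gamma> (nxt (set D) a) - \<gamma> a)"
proof -
  have "a \<in> set D \<inter> {s..<t}" using assms is_partitionD(5)[OF time_partition_set(1)[OF D]] by auto
  then have "a \<in> (!) D ` {..<length D - 1}"
    using bij_betw_imp_surj_on[OF time_partition_set(3)[OF D]] by simp
  then obtain j where j: "j < length D - 1" "a = D ! j" by auto
  then have sj: "Suc j < length D" by simp
  have nx: "nxt (set D) a = D ! Suc j" using time_partition_set(2)[OF D sj] j by simp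
  have so: "sorted_wrt (<) D" using D by (simp add: time_partition_def)
  have lt: "D ! j < D ! Suc j" using sorted_wrt_nth_less[OF so, of j "Suc j"] sj by simp
  have *: "pl_interp \<gamma> D w = \<gamma> a + ((w - a) / (nxt (set D) a - a)) *\<^sub>R (\<gamma> (nxt (set D) a) - \<gamma> a)"
    if "w \<in> {a..nxt (set D) a}" for w
    using pl_interp_segment[OF so sj, of w \<gamma>] that unfolding nx unfolding j(2)
    by (simp add: linepath_def algebra_simps)
  have "(v - u) / (nxt (set D) a - a) = (v - a) / (nxt (set D) a - a) - (u - a) / (nxt (set D) a - a)"
    by (simp add: diff_divide_distrib)
  then show ?thesis unfolding *[OF assms(3)] *[OF assms(4)] by (simp add: scaleR_diff_left)
qed

lemma pl_interp_Lipschitz: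
  obtains M where "0 \<le> M"
    "\<And>u v. s \<le> u \<Longrightarrow> u \<le> v \<Longrightarrow> v \<le> t \<Longrightarrow> norm (pl_interp \<gamma> D v - pl_interp \<gamma> D u) \<le> M * (v - u)"
proof
  let ?X = "set D" and ?p = "pl_interp \<gamma> D"
  have X: "is_partition s t ?X" by (rule time_partition_set(1)[OF D])
  note Xd = is_partitionD[OF X]
  let ?m = "\<lambda>a. norm (\<gamma> (nxt ?X a) - \<gamma> a) / (nxt ?X a - a)"
  \<comment> \<open>The sum of the slopes dominates each of them and is \<open>0\<close> when
    \<open>s = t\<close> leaves no cell.\<close>
  define M where "M = (\<Sum>a \<in> ?X \<inter> {s..<t}. ?m a)"
  have pos: "0 \<le> ?m a" if "a \<in> ?X \<inter> {s..<t}" for a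
    using nxt(2)[OF Xd(1,3), of a] that by auto
  show "0 \<le> M" unfolding M_def using pos by (rule sum_nonneg)
  fix u v assume uv: "s \<le> u" "u \<le> v" "v \<le> t"
  let ?Z = "?X \<union> {u, v}"
  have fZ: "finite ?Z" using Xd by auto
  have "norm (?p v - ?p u) = norm (psum (\<lambda>a b. ?p b - ?p a) ?Z u v)"
    using fZ uv by (subst psum_telescope) auto
  also have "\<dots> \<le> psum (\<lambda>a b. norm (?p b - ?p a)) ?Z u v" by (rule norm_psum)
  also have "\<dots> \<le> psum (\<lambda>a b. M * (b - a)) ?Z u v"
  proof (rule psum_mono)
    fix c assume c: "c \<in> ?Z" "u \<le> c" "c < v"
    let ?d = "nxt ?Z c"
    obtain a where a: "a \<in> ?X" "s \<le> a" "a < t" "a \<le> c" "c < ?d" "?d \<le> nxt ?X a"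
      using locate_refinement[OF Xd(1) fZ _ Xd(2,3) c(1)] c uv by auto
    have "?m a \<le> M" unfolding M_def using a pos Xd(1) by (intro member_le_sum) auto
    then have "?m a * (?d - c) \<le> M * (?d - c)" using a by (intro mult_right_mono) auto
    moreover have "norm (?p ?d - ?p c) = ?m a * (?d - c)"
    proof -
      have "?p ?d - ?p c = ((?d - c) / (nxt ?X a - a)) *\<^sub>R (\<gamma> (nxt ?X a) - \<gamma> a)"
        using a by (intro pl_interp_diff) auto
      moreover have "0 \<le> (?d - c) / (nxt ?X a - a)" using a by auto
      ultimately have "norm (?p ?d - ?p c) = (?d - c) / (nxt ?X a - a) * norm (\<gamma> (nxt ?X a) - \<gamma> a)"
        by (simp only: norm_scaleR abs_of_nonneg)
      then show ?thesis by (simp add: mult.commute)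
    qed
    ultimately show "norm (?p ?d - ?p c) \<le> M * (?d - c)" by simp
  qed
  also have "\<dots> = M * (v - u)"
    using psum_telescope[OF fZ, of u v "\<lambda>x. x"] uv by (simp add: psum_cmult)
  finally show "norm (?p v - ?p u) \<le> M * (v - u)" .
qed

text \<open>In a cell of \<open>D\<close> the increments of the interpolation are multiples of the
  cell increment by ratios in \<open>[0, 1]\<close> that add up to 1. As
  \<open>?r\<^sup>2 \<le> ?r\<close>, their squares add up to at most the square of the cell
  increment.\<close>

lemma psum_pl_interp_le:
  assumes "finite Z" "set D \<subseteq> Z"
  shows "psum (incr_sq (pl_interp \<gamma> D)) Z s t \<le> psum (incr_sq \<gamma>) (set D) s t"
proof -
  let ?X = "set D" and ?p = "pl_interp \<gamma> D"
  have X: "is_partition s t ?X" by (rule time_partition_set(1)[OF D])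
  note Xd = is_partitionD[OF X]
  have "psum (incr_sq ?p) Z s t = psum (psum (incr_sq ?p) Z) ?X s t"
    using psum_refine[of ?X Z s t "incr_sq ?p"] Xd assms by simp
  also have "\<dots> \<le> psum (incr_sq \<gamma>) ?X s t"
  proof (rule psum_mono)
    fix a assume a: "a \<in> ?X" "s \<le> a" "a < t"
    let ?b = "nxt ?X a"
    note n = nxt[OF Xd(1,3) a(3)]
    have "psum (incr_sq ?p) Z a ?b \<le> psum (\<lambda>c d. incr_sq \<gamma> a ?b * ((d - c) / (?b - a))) Z a ?b"
    proof (rule psum_mono)
      fix c assume c: "c \<in> Z" "a \<le> c" "c < ?b"
      let ?r = "(nxt Z c - c) / (?b - a)"
      have m: "c < nxt Z c" "nxt Z c \<le> ?b" using nxt[OF assms(1) _ c(3)] n assms by auto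
      have r: "0 \<le> ?r" "?r \<le> 1" using m c n by (auto simp: field_simps)
      then have "?r\<^sup>2 \<le> ?r" using mult_left_le[of ?r ?r] unfolding power2_eq_square by blast
      then have "?r\<^sup>2 * incr_sq \<gamma> a ?b \<le> ?r * incr_sq \<gamma> a ?b" by (intro mult_right_mono) auto
      then show "incr_sq ?p c (nxt Z c) \<le> incr_sq \<gamma> a ?b * ?r"
        using pl_interp_diff[of a c "nxt Z c" \<gamma>] a c m by (simp add: power_mult_distrib power_divide mult.commute)
    qed
    also have "\<dots> = incr_sq \<gamma> a ?b"
    proof -
      have "psum (\<lambda>c d. d / (?b - a) - c / (?b - a)) Z a ?b = ?b / (?b - a) - a / (?b - a)"
        using assms n a by (intro psum_telescope) auto
      also have "\<dots> = 1" using n by (simp add: diff_divide_distrib[symmetric])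
      finally show ?thesis by (simp add: psum_cmult diff_divide_distrib)
    qed
    finally show "psum (incr_sq ?p) Z a ?b \<le> incr_sq \<gamma> a ?b" .
  qed
  finally show ?thesis .
qed

end

lemma pl_interp_continuous_variation:
  assumes "time_partition 0 T D"
  obtains K where "continuous_on {0..T} (pl_interp \<gamma> D)" "variation_le T K (pl_interp \<gamma> D)"
proof -
  let ?p = "pl_interp \<gamma> D"
  obtain M where M: "0 \<le> M"
    "\<And>u v. 0 \<le> u \<Longrightarrow> u \<le> v \<Longrightarrow> v \<le> T \<Longrightarrow> norm (?p v - ?p u) \<le> M * (v - u)"
    using pl_interp_Lipschitz[OF assms] by metis
  have "M-lipschitz_on {0..T} ?p"
  proof (rule lipschitz_onI)
    fix u v assume "u \<in> {0..T}" "v \<in> {0..T}"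
    then show "dist (?p u) (?p v) \<le> M * dist u v"
      using M(2)[of u v] M(2)[of v u] by (cases "u \<le> v") (auto simp: dist_norm norm_minus_commute)
  qed fact
  then have "continuous_on {0..T} ?p" by (rule lipschitz_on_continuous_on)
  moreover have "variation_le T (M * T) ?p"
    unfolding variation_le_def
  proof (intro allI impI)
    fix X assume X: "is_partition 0 T X"
    note Xd = is_partitionD[OF X]
    have "psum (incr_norm ?p) X 0 T \<le> psum (\<lambda>a b. M * (b - a)) X 0 T"
    proof (rule psum_mono)
      fix a assume a: "a \<in> X" "0 \<le> a" "a < T"
      then show "norm (?p (nxt X a) - ?p a) \<le> M * (nxt X a - a)"
        using nxt[OF Xd(1,3) a(3)] by (intro M(2)) auto
    qed
    also have "\<dots> = M * T" using psum_telescope[of X 0 T "\<lambda>x. x"] Xd by (simp add: psum_cmult)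
    finally show "psum (incr_norm ?p) X 0 T \<le> M * T" .
  qed
  ultimately show thesis by (rule that)
qed

section \<open>Distance between a path and its interpolation\<close>

lemma psum_end_piece:
  assumes "finite Z" "x \<in> Z" "y \<in> Z" "x \<le> y" "Z \<inter> {x<..<y} = {}" "F x x = 0"
  shows "psum F Z x y = F x y"
  \<comment> \<open>For \<open>x = y\<close> the sum is empty and \<open>F x x = 0\<close> matches
    it; end pieces of a cell may degenerate in this way.\<close>
  using psum_one[of Z x y F] assms by (cases "x = y") auto

text \<open>\<open>d\<close> and \<open>d'\<close> are the first and last points of \<open>X\<close>
  in the closed interval. For a cell of \<open>E\<close> and the nodes of \<open>D\<close>, this
  cuts the cell into two end pieces and a middle between nodes.\<close>

lemma refinement_cases:
  fixes X :: "'a::linorder set"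
  assumes "finite X"
  obtains (within) "X \<inter> {e..e'} = {}"
    | (across) d d' where "d \<in> X" "d' \<in> X" "e \<le> d" "d \<le> d'" "d' \<le> e'"
        "X \<inter> {e..<d} = {}" "X \<inter> {d'<..e'} = {}"
proof (cases "X \<inter> {e..e'} = {}")
  case True
  then show thesis by (rule within)
next
  case False
  let ?S = "X \<inter> {e..e'}"
  have f: "finite ?S" using assms by simp
  have i: "Min ?S \<in> ?S" "Max ?S \<in> ?S" using Min_in[OF f False] Max_in[OF f False] by auto
  show thesis
  proof (rule across)
    show "Min ?S \<le> Max ?S" using f i by auto
    have "x \<notin> {e..<Min ?S}" if "x \<in> X" for x
      using Min_le[OF f, of x] i that by fastforce
    then show "X \<inter> {e..<Min ?S} = {}" by blast
    have "x \<notin> {Max ?S<..e'}" if "x \<in> X" for x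
      using Max_ge[OF f, of x] i that by fastforce
    then show "X \<inter> {Max ?S<..e'} = {}" by blast
  qed (use i in auto)
qed

text \<open>Along a refinement of \<open>D\<close>, the quadratic sum of \<gamma> is small because
  the gaps are, and that of the interpolation by \<open>psum_pl_interp_le\<close>. Squaring a
  difference doubles each, whence the 4.\<close>

lemma pl_interp_close_refined:
  assumes D: "time_partition 0 T D" and gaps: "gaps_le \<delta> (set D) 0 T"
    and small: "\<forall>X. is_partition 0 T X \<and> gaps_le \<delta> X 0 T \<longrightarrow> psum (incr_sq \<gamma>) X 0 T \<le> \<epsilon>"
    and Z: "is_partition 0 T Z" "set D \<subseteq> Z"
  shows "psum (incr_sq (\<lambda>u. \<gamma> u - pl_interp \<gamma> D u)) Z 0 T \<le> 4 * \<epsilon>"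
proof -
  let ?p = "pl_interp \<gamma> D" and ?h = "\<lambda>u. \<gamma> u - pl_interp \<gamma> D u"
  have X: "is_partition 0 T (set D)" by (rule time_partition_set(1)[OF D])
  have "gaps_le \<delta> Z 0 T"
    using gaps_le_refine[OF gaps] Z is_partitionD[OF X] is_partitionD[OF Z(1)] by blast
  then have 1: "psum (incr_sq \<gamma>) Z 0 T \<le> \<epsilon>" using small Z by blast
  have "psum (incr_sq ?p) Z 0 T \<le> psum (incr_sq \<gamma>) (set D) 0 T"
    by (rule psum_pl_interp_le[OF D]) (use Z is_partitionD[OF Z(1)] in auto)
  also have "\<dots> \<le> \<epsilon>" using small X gaps by blast
  finally have 2: "psum (incr_sq ?p) Z 0 T \<le> \<epsilon>" .
  have "psum (incr_sq ?h) Z 0 T \<le> psum (\<lambda>a b. 2 * incr_sq \<gamma> a b + 2 * incr_sq ?p a b) Z 0 T"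
  proof (rule psum_mono)
    fix a
    have "?h (nxt Z a) - ?h a = (\<gamma> (nxt Z a) - \<gamma> a) + (?p a - ?p (nxt Z a))" by simp
    then show "incr_sq ?h a (nxt Z a) \<le> 2 * incr_sq \<gamma> a (nxt Z a) + 2 * incr_sq ?p a (nxt Z a)"
      using power2_norm_triangle[of "\<gamma> (nxt Z a) - \<gamma> a" "?p a - ?p (nxt Z a)"]
      by (simp only: norm_minus_commute[of "?p a"])
  qed
  then show ?thesis using 1 2 by (simp add: psum_add psum_cmult)
qed

text \<open>The difference vanishes at the nodes of \<open>D\<close>, so its increment over a cell
  of \<open>E\<close> reduces to the two end pieces and the middle drops out. Squaring doubles
  \<open>4 * \<epsilon>\<close> to \<open>8 * \<epsilon>\<close>.\<close>

lemma pl_interp_close: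
  assumes D: "time_partition 0 T D" and gaps: "gaps_le \<delta> (set D) 0 T"
    and small: "\<forall>X. is_partition 0 T X \<and> gaps_le \<delta> X 0 T \<longrightarrow> psum (incr_sq \<gamma>) X 0 T \<le> \<epsilon>"
    and E: "is_partition 0 T E"
  shows "psum (incr_sq (\<lambda>u. \<gamma> u - pl_interp \<gamma> D u)) E 0 T \<le> 8 * \<epsilon>"
proof -
  let ?h = "\<lambda>u. \<gamma> u - pl_interp \<gamma> D u" and ?Z = "E \<union> set D"
  have X: "is_partition 0 T (set D)" by (rule time_partition_set(1)[OF D])
  have Z: "is_partition 0 T ?Z" using E X by (rule is_partition_Un)
  note Ed = is_partitionD[OF E] and Xd = is_partitionD[OF X] and Zd = is_partitionD[OF Z]
  have h0: "?h x = 0" if "x \<in> set D" for x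
    using pl_interp_node[of D x \<gamma>] D that by (simp add: time_partition_def)
  have "psum (incr_sq ?h) E 0 T \<le> psum (\<lambda>a b. 2 * psum (incr_sq ?h) ?Z a b) E 0 T"
  proof (rule psum_mono)
    fix e assume e: "e \<in> E" "0 \<le> e" "e < T"
    let ?e = "nxt E e"
    note n = nxt[OF Ed(1,3) e(3)] and ne = nxt_empty[OF Ed(1,3) e(3)]
    have sub: "E \<inter> {x<..<y} = {}" if "e \<le> x" "y \<le> ?e" for x y using ne that by fastforce
    show "incr_sq ?h e ?e \<le> 2 * psum (incr_sq ?h) ?Z e ?e"
      using Xd(1)
    proof (cases rule: refinement_cases[of "set D" e ?e])
      case within
      then have "?Z \<inter> {e<..<?e} = {}" using ne by fastforce
      then have "psum (incr_sq ?h) ?Z e ?e = incr_sq ?h e ?e"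
        using e n Zd(1) by (intro psum_end_piece) auto
      then show ?thesis by simp
    next
      case (across d d')
      have "E \<inter> {e<..<d} = {}" "E \<inter> {d'<..<?e} = {}" using across by (auto intro!: sub)
      moreover have "{e<..<d} \<subseteq> {e..<d}" "{d'<..<?e} \<subseteq> {d'<..?e}" by auto
      ultimately have "?Z \<inter> {e<..<d} = {}" "?Z \<inter> {d'<..<?e} = {}" using across(6,7) by blast+
      then have 1: "psum (incr_sq ?h) ?Z e d = incr_sq ?h e d" "psum (incr_sq ?h) ?Z d' ?e = incr_sq ?h d' ?e"
        using e n Zd(1) across by (auto intro!: psum_end_piece)
      have "psum (incr_sq ?h) ?Z e ?e = incr_sq ?h e d + psum (incr_sq ?h) ?Z d d' + incr_sq ?h d' ?e"
        using psum_split[OF Zd(1), of e d ?e "incr_sq ?h"] psum_split[OF Zd(1), of d d' ?e "incr_sq ?h"] across 1 by simp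
      moreover have "0 \<le> psum (incr_sq ?h) ?Z d d'" by (rule psum_nonneg) simp
      moreover have "?h ?e - ?h e = (?h d - ?h e) + (?h ?e - ?h d')"
        using h0[OF across(1)] h0[OF across(2)] by simp
      then have "incr_sq ?h e ?e \<le> 2 * incr_sq ?h e d + 2 * incr_sq ?h d' ?e"
        using power2_norm_triangle[of "?h d - ?h e" "?h ?e - ?h d'"] by (simp only:)
      ultimately show ?thesis by simp
    qed
  qed
  also have "\<dots> = 2 * psum (incr_sq ?h) ?Z 0 T"
    using psum_refine[of E ?Z 0 T "incr_sq ?h"] Ed Zd(1) by (simp add: psum_cmult)
  also have "\<dots> \<le> 8 * \<epsilon>" using pl_interp_close_refined[OF D gaps small Z] by simp
  finally show ?thesis .
qed

section \<open>Interpolated areas and geometric rough paths\<close>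

context bounded_tensor
begin

section \<open>Areas of interpolated paths\<close>

lemma area_refl:
  assumes "continuous_on {0..T} \<gamma>" "variation_le T K \<gamma>" "0 \<le> s" "s \<le> T"
  shows "area tns \<gamma> (s, s) = 0"
  using assms by (intro area_linear_segment[OF assms(1,2), of s s 0]) auto

lemma area_pl_interp_cell:
  assumes D: "time_partition 0 T D" and uv: "0 \<le> u" "u \<le> v" "v \<le> T" "set D \<inter> {u<..<v} = {}"
  shows "area tns (pl_interp \<gamma> D) (u, v) = 0"
proof -
  let ?X = "set D"
  obtain K where p: "continuous_on {0..T} (pl_interp \<gamma> D)" "variation_le T K (pl_interp \<gamma> D)"
    by (rule pl_interp_continuous_variation[OF D])
  note Xd = is_partitionD[OF time_partition_set(1)[OF D]]
  show ?thesis
  proof (cases "u = v")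
    case True
    then show ?thesis using area_refl[OF p] uv by simp
  next
    case False
    then have "u < v" using uv by simp
    then obtain a where a: "a \<in> ?X" "0 \<le> a" "a \<le> u" "u < nxt ?X a" "a < T"
      using locate[OF Xd(1-3), of u] uv by auto
    \<comment> \<open>The successor of \<open>a\<close> is a node above \<open>u\<close>, and no
      node is strictly between \<open>u\<close> and \<open>v\<close>; hence both points lie on one
      linear piece.\<close>
    have "v \<le> nxt ?X a" using uv(4) a nxt(1)[OF Xd(1,3) a(5)] by force
    then show ?thesis
      using a uv pl_interp_diff[OF D a(1,5), of _ _ \<gamma>]
      by (intro area_linear_segment[OF p, of _ _ "(1 / (nxt ?X a - a)) *\<^sub>R (\<gamma> (nxt ?X a) - \<gamma> a)"]) auto
  qed
qed

text \<open>The difference of the bracket terms in Chen's relation for a path and for its interpolation; the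
  weight \<open>\<kappa>\<close> comes from Young's inequality, applied so that the small factors \<open>x\<close>, \<open>y\<close> carry \<open>1/\<kappa>\<close>.\<close>
lemma norm_chen_defect:
  assumes "0 < \<kappa>"
  shows "norm ((1/2) *\<^sub>R (B p q - B (p + x) (q - y) + B r y)) \<le>
    (1/\<kappa> + 1) * ((norm x)\<^sup>2 + (norm y)\<^sup>2) + \<kappa> * ((norm (p + r))\<^sup>2 + (norm q)\<^sup>2)"
proof -
  have young: "a * b \<le> a\<^sup>2 / \<kappa> + \<kappa> * b\<^sup>2" for a b :: real
  proof -
    have "\<kappa> * (a\<^sup>2 / \<kappa> + \<kappa> * b\<^sup>2) = a\<^sup>2 + (\<kappa> * b)\<^sup>2"
      using assms by (simp add: distrib_left power_mult_distrib power2_eq_square)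
    moreover have "2 * (\<kappa> * (a * b)) \<le> a\<^sup>2 + (\<kappa> * b)\<^sup>2"
      using sum_squares_bound[of a "\<kappa> * b"] by (simp add: mult.left_commute mult.assoc)
    then have "\<kappa> * (a * b) \<le> a\<^sup>2 + (\<kappa> * b)\<^sup>2"
      using zero_le_power2[of a] zero_le_power2[of "\<kappa> * b"] by linarith
    ultimately have "\<kappa> * (a * b) \<le> \<kappa> * (a\<^sup>2 / \<kappa> + \<kappa> * b\<^sup>2)" by simp
    then show ?thesis using assms by (simp only: mult_le_cancel_left_pos)
  qed
  \<comment> \<open>\<open>B p q\<close> cancels on expansion, and each remaining term contains
    \<open>x\<close> or \<open>y\<close>.\<close>
  have "B p q - B (p + x) (q - y) + B r y = B (p + r) y - B x q + B x y"
    by (simp add: bracket.add_left bracket.diff_right algebra_simps)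
  then have "norm ((1/2) *\<^sub>R (B p q - B (p + x) (q - y) + B r y)) = norm (B (p + r) y - B x q + B x y) / 2"
    by simp
  also have "\<dots> \<le> (norm (B (p + r) y) + norm (B x q) + norm (B x y)) / 2"
    using norm_triangle_ineq[of "B (p + r) y - B x q" "B x y"] norm_triangle_ineq4[of "B (p + r) y" "B x q"] by simp
  also have "\<dots> \<le> norm y * norm (p + r) + norm x * norm q + norm x * norm y"
    using norm_bracket[of "p + r" y] norm_bracket[of x q] norm_bracket[of x y] by (simp add: mult.commute)
  also have "norm y * norm (p + r) \<le> (norm y)\<^sup>2 / \<kappa> + \<kappa> * (norm (p + r))\<^sup>2" by (rule young)
  also have "norm x * norm q \<le> (norm x)\<^sup>2 / \<kappa> + \<kappa> * (norm q)\<^sup>2" by (rule young)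
  also have "norm x * norm y \<le> (norm x)\<^sup>2 + (norm y)\<^sup>2"
    using sum_squares_bound[of "norm x" "norm y"] zero_le_power2[of "norm x"] zero_le_power2[of "norm y"]
    by linarith
  finally show ?thesis by (simp add: algebra_simps add_divide_distrib)
qed

text \<open>Each term on the right can be made small: the first two because \<open>Z\<close> refines
  a fine \<open>D\<close>, the last by a small \<kappa>, as the quadratic sums of \<gamma> are
  bounded. So \<kappa> has to be chosen before the mesh bound.\<close>

lemma area_pl_interp_dist:
  assumes D: "time_partition 0 T D"
    and chen: "\<And>s u t. 0 \<le> s \<Longrightarrow> s \<le> u \<Longrightarrow> u \<le> t \<Longrightarrow> t \<le> T \<Longrightarrow>
      \<alpha> (s, t) = \<alpha> (s, u) + \<alpha> (u, t) + (1/2) *\<^sub>R B (\<gamma> u - \<gamma> s) (\<gamma> t - \<gamma> u)"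
    and E: "is_partition 0 T E" and \<kappa>: "0 < \<kappa>"
  defines "Z \<equiv> E \<union> set D" and "h \<equiv> \<lambda>u. \<gamma> u - pl_interp \<gamma> D u"
  shows "psum (\<lambda>a b. norm (area tns (pl_interp \<gamma> D) (a, b) - \<alpha> (a, b))) E 0 T \<le>
    psum (\<lambda>a b. norm (\<alpha> (a, b))) Z 0 T + (1/\<kappa> + 1) * psum (incr_sq h) Z 0 T
     + \<kappa> * (4 * psum (incr_sq \<gamma>) E 0 T + 2 * psum (incr_sq \<gamma>) Z 0 T)"
proof -
  let ?X = "set D" and ?p = "pl_interp \<gamma> D"
  let ?A = "area tns ?p" and ?\<alpha> = "\<lambda>a b. norm (\<alpha> (a, b))"
  define \<phi> where "\<phi> a b = \<alpha> (a, b) - ?A (a, b)" for a b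
  obtain K where p: "continuous_on {0..T} ?p" "variation_le T K ?p"
    by (rule pl_interp_continuous_variation[OF D])
  have X: "is_partition 0 T ?X" by (rule time_partition_set(1)[OF D])
  have Z: "is_partition 0 T Z" unfolding Z_def using E X by (rule is_partition_Un)
  note Ed = is_partitionD[OF E] and Xd = is_partitionD[OF X] and Zd = is_partitionD[OF Z]
  have h0: "?p x = \<gamma> x" if "x \<in> ?X" for x
    using pl_interp_node[of D x \<gamma>] D that by (simp add: time_partition_def)
  \<comment> \<open>Chen's relation at three equal points reads
    \<open>\<alpha> (s, s) = \<alpha> (s, s) + \<alpha> (s, s)\<close>.\<close>
  have \<alpha>0: "\<alpha> (s, s) = 0" if "0 \<le> s" "s \<le> T" for s using chen[of s s s] that by simp
  have \<phi>_chen: "\<phi> s t = \<phi> s u + \<phi> u t + (1/2) *\<^sub>R (B (\<gamma> u - \<gamma> s) (\<gamma> t - \<gamma> u) - B (?p u - ?p s) (?p t - ?p u))"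
    if "0 \<le> s" "s \<le> u" "u \<le> t" "t \<le> T" for s u t
    unfolding \<phi>_def chen[OF that] area_chen[OF p that] by (simp add: scaleR_diff_right)
  \<comment> \<open>The right-hand side localised to one cell of \<open>E\<close>; summed over
    \<open>E\<close> it gives the claimed bound.\<close>
  let ?R = "\<lambda>a b. psum ?\<alpha> Z a b + (1/\<kappa> + 1) * psum (incr_sq h) Z a b
     + \<kappa> * (4 * incr_sq \<gamma> a b + 2 * psum (incr_sq \<gamma>) Z a b)"
  have nonneg: "0 \<le> psum (incr_sq f) Z a b" for f :: "real \<Rightarrow> 'v" and a b by (rule psum_nonneg) simp
  have "psum (\<lambda>a b. norm (?A (a, b) - \<alpha> (a, b))) E 0 T \<le> psum ?R E 0 T"
  proof (rule psum_mono)
    fix e assume e: "e \<in> E" "0 \<le> e" "e < T"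
    let ?e = "nxt E e"
    note n = nxt[OF Ed(1,3) e(3)] and ne = nxt_empty[OF Ed(1,3) e(3)]
    have eT: "?e \<le> T" "0 \<le> ?e" using n e by auto
    have eZ: "e \<in> Z" "?e \<in> Z" using e n by (auto simp: Z_def)
    have sub: "E \<inter> {x<..<y} = {}" if "e \<le> x" "y \<le> ?e" for x y using ne that by fastforce
    have "norm (\<phi> e ?e) \<le> ?R e ?e"
      using Xd(1)
    proof (cases rule: refinement_cases[of ?X e ?e])
      case within
      \<comment> \<open>The interpolation is linear on the whole cell, so \<phi> agrees with
        \<alpha> there and the first term of \<open>?R\<close> is enough.\<close>
      have i: "{e<..<?e} \<subseteq> {e..?e}" by auto
      have emp: "?X \<inter> {e<..<?e} = {}" using within i by blast
      then have "Z \<inter> {e<..<?e} = {}" using ne unfolding Z_def by blast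
      then have "psum ?\<alpha> Z e ?e = ?\<alpha> e ?e"
        using e n Zd(1) eZ \<alpha>0[of e] by (intro psum_end_piece) auto
      moreover have "?A (e, ?e) = 0" using e n emp eT by (intro area_pl_interp_cell[OF D]) auto
      moreover have "0 \<le> (1/\<kappa> + 1) * psum (incr_sq h) Z e ?e"
        "0 \<le> \<kappa> * (4 * incr_sq \<gamma> e ?e + 2 * psum (incr_sq \<gamma>) Z e ?e)"
        using \<kappa> nonneg[of h e ?e] nonneg[of \<gamma> e ?e] by simp_all
      ultimately show ?thesis by (simp add: \<phi>_def)
    next
      case (across d d')
      have dZ: "d \<in> Z" "d' \<in> Z" using across by (auto simp: Z_def)
      have i: "{e<..<d} \<subseteq> {e..<d}" "{d'<..<?e} \<subseteq> {d'<..?e}" by auto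
      have Xe: "?X \<inter> {e<..<d} = {}" "?X \<inter> {d'<..<?e} = {}" using across(6,7) i by blast+
      have "E \<inter> {e<..<d} = {}" "E \<inter> {d'<..<?e} = {}" using across by (auto intro!: sub)
      then have Ze: "Z \<inter> {e<..<d} = {}" "Z \<inter> {d'<..<?e} = {}" using Xe unfolding Z_def by blast+
      have pieces: "psum F Z e ?e = F e d + psum F Z d d' + F d' ?e" if "F e e = 0" "F ?e ?e = 0" "F d' d' = 0"
        for F :: "real \<Rightarrow> real \<Rightarrow> real"
      proof -
        have "psum F Z e d = F e d" "psum F Z d' ?e = F d' ?e"
          using Zd(1) eZ dZ across Ze that by (auto intro!: psum_end_piece)
        then show ?thesis
          using psum_split[OF Zd(1), of e d ?e F] psum_split[OF Zd(1), of d d' ?e F] across by simp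
      qed
      have dT: "0 \<le> d" "d \<le> T" "0 \<le> d'" "d' \<le> T" using across e eT by auto
      have \<phi>1: "\<phi> e d = \<alpha> (e, d)" "\<phi> d' ?e = \<alpha> (d', ?e)"
        using area_pl_interp_cell[OF D, of e d \<gamma>] area_pl_interp_cell[OF D, of d' ?e \<gamma>] across e eT Xe dT
        by (auto simp: \<phi>_def)
      \<comment> \<open>Path and interpolation agree at nodes, so the two brackets cancel and \<phi>
        is additive on the nodes in \<open>[d, d']\<close>.\<close>
      have "norm (\<phi> d d') = norm (psum \<phi> ?X d d')"
      proof -
        have add: "\<phi> a c = \<phi> a b + \<phi> b c" if "a \<in> ?X" "b \<in> ?X" "c \<in> ?X" "d \<le> a" "a \<le> b" "b \<le> c" "c \<le> d'" for a b c
          using \<phi>_chen[of a b c] that h0 dT by simp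
        have "psum \<phi> ?X d d' = \<phi> d d'" by (rule psum_additive[OF Xd(1) across(1,2,4) add])
        then show ?thesis by simp
      qed
      also have "\<dots> \<le> psum (\<lambda>a b. norm (\<phi> a b)) ?X d d'" by (rule norm_psum)
      also have "\<dots> = psum ?\<alpha> ?X d d'"
      proof (rule psum_cong)
        fix a assume a: "a \<in> ?X" "d \<le> a" "a < d'"
        note m = nxt[OF Xd(1) across(2) a(3)]
        have "?A (a, nxt ?X a) = 0"
          using m a dT nxt_empty[OF Xd(1) across(2) a(3)] by (intro area_pl_interp_cell[OF D]) auto
        then show "norm (\<phi> a (nxt ?X a)) = ?\<alpha> a (nxt ?X a)" by (simp add: \<phi>_def)
      qed (use Xd across in auto)
      also have "\<dots> = psum ?\<alpha> Z d d'"
      proof (rule psum_cong_set)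
        \<comment> \<open>The cell of \<open>E\<close> has no interior point of \<open>E\<close>, so
          a point of \<open>E\<close> in \<open>[d, d']\<close> is \<open>d\<close> or
          \<open>d'\<close>.\<close>
        show "?X \<inter> {d..d'} = Z \<inter> {d..d'}"
        proof -
          have "x \<in> ?X" if "x \<in> E" "d \<le> x" "x \<le> d'" for x
          proof -
            have "x \<notin> {e<..<?e}" using ne that by blast
            then have "x = d \<or> x = d'" using that across by auto
            then show ?thesis using across by auto
          qed
          then show ?thesis by (auto simp: Z_def)
        qed
      qed (use Xd Zd across in auto)
      finally have \<phi>2: "norm (\<phi> d d') \<le> psum ?\<alpha> Z d d'" .
      txt \<open>\<open>\<phi>\<close> fails to be additive along \<open>e \<le> d \<le> d' \<le> ?e\<close> only through bracket terms, and each of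
        these contains an increment of \<open>h\<close>, because \<open>h\<close> vanishes at \<open>d\<close> and \<open>d'\<close>.\<close>
      define p q x y r where "p = \<gamma> d - \<gamma> e" and "q = \<gamma> ?e - \<gamma> d" and "x = h e" and "y = h ?e" and "r = \<gamma> d' - \<gamma> d"
      have eq: "\<phi> e ?e = \<phi> e d + \<phi> d d' + \<phi> d' ?e + (1/2) *\<^sub>R (B p q - B (p + x) (q - y) + B r y)"
      proof -
        have "?p d - ?p e = p + x" "?p ?e - ?p d = q - y"
          by (simp_all add: p_def q_def x_def y_def h_def h0[OF across(1)])
        moreover have "B (\<gamma> d' - \<gamma> d) (\<gamma> ?e - \<gamma> d') - B (?p d' - ?p d) (?p ?e - ?p d') = B r y"
          by (simp add: r_def y_def h_def h0[OF across(1)] h0[OF across(2)] bracket.diff_right[symmetric])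
        ultimately show ?thesis
          using \<phi>_chen[of e d ?e] \<phi>_chen[of d d' ?e] across dT eT e
          by (simp add: p_def q_def scaleR_add_right)
      qed
      have 1: "norm (\<phi> e ?e) \<le> norm (\<phi> e d) + norm (\<phi> d d') + norm (\<phi> d' ?e) +
        norm ((1/2) *\<^sub>R (B p q - B (p + x) (q - y) + B r y))"
        unfolding eq
        using norm_triangle_ineq[of "\<phi> e d + \<phi> d d' + \<phi> d' ?e" "(1/2) *\<^sub>R (B p q - B (p + x) (q - y) + B r y)"]
          norm_triangle_ineq[of "\<phi> e d + \<phi> d d'" "\<phi> d' ?e"] norm_triangle_ineq[of "\<phi> e d" "\<phi> d d'"] by linarith
      have 2: "norm (\<phi> e d) + norm (\<phi> d d') + norm (\<phi> d' ?e) \<le> psum ?\<alpha> Z e ?e"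
        using pieces[of ?\<alpha>] \<phi>1 \<phi>2 \<alpha>0 e eT dT by simp
      \<comment> \<open>As \<open>h\<close> vanishes at \<open>d\<close> and \<open>d'\<close>, its
        values at the ends of the cell are, up to sign, its increments over the end pieces.\<close>
      have "(norm x)\<^sup>2 + (norm y)\<^sup>2 = incr_sq h e d + incr_sq h d' ?e"
        using h0 across by (simp add: x_def y_def h_def norm_minus_commute)
      then have xy: "(norm x)\<^sup>2 + (norm y)\<^sup>2 \<le> psum (incr_sq h) Z e ?e"
        using pieces[of "incr_sq h"] nonneg[of h d d'] by simp
      \<comment> \<open>\<open>p + r\<close> and \<open>q\<close> need not be increments along
        \<open>E\<close> or \<open>Z\<close>; each is the increment over the cell of
        \<open>E\<close> less that over an end piece. This is why both partitions occur in the
        bound.\<close>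
      have pr: "p + r = (\<gamma> ?e - \<gamma> e) + (\<gamma> d' - \<gamma> ?e)" and q: "q = (\<gamma> ?e - \<gamma> e) + (\<gamma> e - \<gamma> d)"
        by (simp_all add: p_def q_def r_def)
      have "(norm (p + r))\<^sup>2 \<le> 2 * incr_sq \<gamma> e ?e + 2 * incr_sq \<gamma> d' ?e"
        using power2_norm_triangle[of "\<gamma> ?e - \<gamma> e" "\<gamma> d' - \<gamma> ?e"] unfolding pr by (simp only: norm_minus_commute)
      moreover have "(norm q)\<^sup>2 \<le> 2 * incr_sq \<gamma> e ?e + 2 * incr_sq \<gamma> e d"
        using power2_norm_triangle[of "\<gamma> ?e - \<gamma> e" "\<gamma> e - \<gamma> d"] unfolding q by (simp only: norm_minus_commute)
      ultimately have prq: "(norm (p + r))\<^sup>2 + (norm q)\<^sup>2 \<le> 4 * incr_sq \<gamma> e ?e + 2 * psum (incr_sq \<gamma>) Z e ?e"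
        using pieces[of "incr_sq \<gamma>"] nonneg[of \<gamma> d d'] by simp
      have "norm ((1/2) *\<^sub>R (B p q - B (p + x) (q - y) + B r y)) \<le>
        (1/\<kappa> + 1) * ((norm x)\<^sup>2 + (norm y)\<^sup>2) + \<kappa> * ((norm (p + r))\<^sup>2 + (norm q)\<^sup>2)"
        by (rule norm_chen_defect[OF \<kappa>])
      also have "\<dots> \<le> (1/\<kappa> + 1) * psum (incr_sq h) Z e ?e + \<kappa> * (4 * incr_sq \<gamma> e ?e + 2 * psum (incr_sq \<gamma>) Z e ?e)"
        using \<kappa> by (intro add_mono[OF mult_left_mono[OF xy] mult_left_mono[OF prq]]) auto
      finally show ?thesis using 1 2 by linarith
    qed
    then show "norm (?A (e, ?e) - \<alpha> (e, ?e)) \<le> ?R e ?e" by (simp add: \<phi>_def norm_minus_commute)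
  qed
  also have "psum ?R E 0 T = psum ?\<alpha> Z 0 T + (1/\<kappa> + 1) * psum (incr_sq h) Z 0 T
     + \<kappa> * (4 * psum (incr_sq \<gamma>) E 0 T + 2 * psum (incr_sq \<gamma>) Z 0 T)"
    using psum_refine[of E Z 0 T ?\<alpha>] psum_refine[of E Z 0 T "incr_sq h"] psum_refine[of E Z 0 T "incr_sq \<gamma>"] Ed Zd(1)
    by (simp add: psum_add psum_cmult)
  finally show ?thesis .
qed

section \<open>From convergent areas to a geometric rough path\<close>

lemma areas_converge_imp_geometric:
  assumes T: "0 < T" and \<gamma>: "\<gamma> \<in> C0_pvar 2 T"
    and conv: "areas_converge_in_1var tns T \<gamma>"
  shows "\<gamma> \<in> G2 tns T"
proof -
  obtain \<alpha> where \<alpha>: "\<alpha> \<in> C_triangle T (bracket_space tns)"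
    and lim: "((\<lambda>D. pvar 1 T (\<lambda>x. area tns (pl_interp \<gamma> D) x - \<alpha> x)) \<longlongrightarrow> 0) (mesh_to_0 T)"
    using conv by (auto simp: areas_converge_in_1var_def)
  let ?dist = "\<lambda>D. ennreal_powr ((pvar 2 T (increments (\<lambda>u. \<gamma> u - pl_interp \<gamma> D u)))\<^sup>2
              + pvar 1 T (\<lambda>x. \<alpha> x - area tns (pl_interp \<gamma> D) x)) (1/2)"
  have "(?dist \<longlongrightarrow> 0) (mesh_to_0 T)"
    unfolding tendsto_0_ennreal_iff
  proof (intro allI impI)
    fix r :: real assume "0 < r"
    \<comment> \<open>\<open>rough_distance_le\<close> gives the bound \<open>2 * e\<close>.\<close>
    define e where "e = r / 2"
    have e: "0 < e" "r = 2 * e" using \<open>0 < r\<close> by (auto simp: e_def)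
    \<comment> \<open>The 8 offsets the factor in \<open>pl_interp_close\<close>.\<close>
    obtain \<delta> where \<delta>: "0 < \<delta>" "\<forall>X. is_partition 0 T X \<and> gaps_le \<delta> X 0 T \<longrightarrow> psum (incr_sq \<gamma>) X 0 T \<le> e\<^sup>2 / 8"
      using C0_pvar_2_modulus[OF \<gamma>, of "e\<^sup>2 / 8"] e by auto
    have "eventually (\<lambda>D. time_partition 0 T D \<and> mesh D \<le> \<delta>) (mesh_to_0 T)"
      using \<delta>(1) by (auto simp: eventually_mesh_to_0)
    moreover have "eventually (\<lambda>D. pvar 1 T (\<lambda>x. area tns (pl_interp \<gamma> D) x - \<alpha> x) \<le> ennreal (e\<^sup>2)) (mesh_to_0 T)"
      using lim e by (simp add: tendsto_0_ennreal_iff)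
    ultimately show "eventually (\<lambda>D. ?dist D \<le> ennreal r) (mesh_to_0 T)"
    proof eventually_elim
      case (elim D)
      have g: "gaps_le \<delta> (set D) 0 T" using elim \<delta>(1) mesh_le_iff[of 0 T D \<delta>] by auto
      have "pvar 2 T (increments (\<lambda>u. \<gamma> u - pl_interp \<gamma> D u)) \<le> ennreal e"
        using e(1) pl_interp_close[OF _ g \<delta>(2)] elim by (subst pvar_2_increments_le_iff) auto
      moreover have "pvar 1 T (\<lambda>x. \<alpha> x - area tns (pl_interp \<gamma> D) x) \<le> ennreal (e\<^sup>2)"
        using elim by (simp add: pvar_1_le_iff norm_minus_commute)
      ultimately show ?case unfolding e(2) using e(1) by (intro rough_distance_le) auto
    qed
  qed
  \<comment> \<open>The convergence is along a filter of partitions, whereas a geometric rough path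
    requires a sequence; meshes below \<open>1 / real (Suc n)\<close> provide one.\<close>
  moreover have "\<exists>D. time_partition 0 T D \<and> \<bar>mesh D\<bar> < 1 / real (Suc n)" for n
    using T by (intro ex_time_partition) auto
  then obtain D where D: "\<And>n. time_partition 0 T (D n)" "\<And>n. \<bar>mesh (D n)\<bar> < 1 / real (Suc n)"
    by metis
  have "filterlim D (mesh_to_0 T) sequentially"
    unfolding filterlim_iff
  proof (intro allI impI)
    fix P assume "eventually P (mesh_to_0 T)"
    then obtain \<delta> where \<delta>: "\<delta> > 0" "\<And>D. time_partition 0 T D \<Longrightarrow> mesh D \<le> \<delta> \<Longrightarrow> P D"
      by (auto simp: eventually_mesh_to_0)
    have "eventually (\<lambda>n. 1 / real (Suc n) < \<delta>) sequentially"
      using order_tendstoD(2)[OF LIMSEQ_Suc[OF lim_1_over_n] \<delta>(1)] .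
    then show "eventually (\<lambda>n. P (D n)) sequentially"
    proof (rule eventually_mono)
      fix n assume "1 / real (Suc n) < \<delta>"
      then show "P (D n)" using D(1)[of n] D(2)[of n] by (intro \<delta>(2)) auto
    qed
  qed
  ultimately have "(\<lambda>n. ?dist (D n)) \<longlonglongrightarrow> 0" by (rule filterlim_compose)
  moreover have "pl_interp \<gamma> (D n) \<in> C_pvar 1 T" for n
    using pl_interp_continuous_variation[OF D(1)[of n], of \<gamma>] T by (metis C_pvar_1_iff less_imp_le)
  ultimately have "geometric_2_rough_path tns T \<gamma> \<alpha>"
    unfolding geometric_2_rough_path_def using \<alpha> \<gamma>
    by (auto simp: C0_pvar_def intro!: exI[of _ "\<lambda>n. pl_interp \<gamma> (D n)"])
  then show ?thesis using \<gamma> by (auto simp: G2_def)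
qed

section \<open>From a geometric rough path to convergent areas\<close>

lemma geometric_imp_areas_converge:
  assumes T: "0 < T" and "\<gamma> \<in> G2 tns T"
  shows "areas_converge_in_1var tns T \<gamma>"
proof -
  from assms(2) obtain \<alpha> where \<gamma>: "\<gamma> \<in> C0_pvar 2 T" and "geometric_2_rough_path tns T \<gamma> \<alpha>"
    by (auto simp: G2_def)
  then obtain \<gamma>n where \<alpha>: "\<alpha> \<in> C_triangle T (bracket_space tns)"
    and \<gamma>n: "\<And>n. \<gamma>n n \<in> C_pvar 1 T"
    and lim: "(\<lambda>n. ennreal_powr ((pvar 2 T (increments (\<lambda>u. \<gamma> u - \<gamma>n n u)))\<^sup>2
              + pvar 1 T (\<lambda>x. \<alpha> x - area tns (\<gamma>n n) x)) (1/2)) \<longlonglongrightarrow> 0"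
    unfolding geometric_2_rough_path_def by blast
  have T0: "0 \<le> T" using T by simp
  have cont: "continuous_on {0..T} (\<gamma>n n)" for n using \<gamma>n[of n] C_pvar_1_iff[OF T0] by blast
  have "\<exists>K. variation_le T K (\<gamma>n n)" for n using \<gamma>n[of n] C_pvar_1_iff[OF T0] by blast
  then obtain K where var: "\<And>n. variation_le T (K n) (\<gamma>n n)" by metis
  have close: "eventually (\<lambda>n. (\<forall>X. is_partition 0 T X \<longrightarrow> psum (incr_sq (\<lambda>u. \<gamma> u - \<gamma>n n u)) X 0 T \<le> e\<^sup>2) \<and>
      (\<forall>X. is_partition 0 T X \<longrightarrow> psum (\<lambda>a b. norm (\<alpha> (a, b) - area tns (\<gamma>n n) (a, b))) X 0 T \<le> e\<^sup>2)) sequentially"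
    if e: "0 < e" for e
  proof -
    have "eventually (\<lambda>n. ennreal_powr ((pvar 2 T (increments (\<lambda>u. \<gamma> u - \<gamma>n n u)))\<^sup>2
              + pvar 1 T (\<lambda>x. \<alpha> x - area tns (\<gamma>n n) x)) (1/2) \<le> ennreal e) sequentially"
      using lim e by (simp add: tendsto_0_ennreal_iff)
    then show ?thesis
    proof (rule eventually_mono)
      fix n assume "ennreal_powr ((pvar 2 T (increments (\<lambda>u. \<gamma> u - \<gamma>n n u)))\<^sup>2
              + pvar 1 T (\<lambda>x. \<alpha> x - area tns (\<gamma>n n) x)) (1/2) \<le> ennreal e"
      from rough_distance_leD[OF less_imp_le[OF e] this]
      show "(\<forall>X. is_partition 0 T X \<longrightarrow> psum (incr_sq (\<lambda>u. \<gamma> u - \<gamma>n n u)) X 0 T \<le> e\<^sup>2) \<and>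
        (\<forall>X. is_partition 0 T X \<longrightarrow> psum (\<lambda>a b. norm (\<alpha> (a, b) - area tns (\<gamma>n n) (a, b))) X 0 T \<le> e\<^sup>2)"
        using e by (simp add: pvar_1_le_iff pvar_2_increments_le_iff)
    qed
  qed
  \<comment> \<open>Testing with the partition \<open>{0, s, t, T}\<close> bounds a single value, so
    convergence in variation yields pointwise convergence of increments and areas.\<close>
  have single: "F s t \<le> c"
    if "\<forall>X. is_partition 0 T X \<longrightarrow> psum F X 0 T \<le> c" "\<And>a b. 0 \<le> F a b" "F s s = 0" "0 \<le> s" "s \<le> t" "t \<le> T"
    for F :: "real \<Rightarrow> real \<Rightarrow> real" and s t c
  proof -
    let ?X = "{0, s, t, T}"
    have "F s t = psum F ?X s t" using that by (intro psum_end_piece[symmetric]) auto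
    also have "\<dots> \<le> psum F ?X 0 T" using that by (intro psum_mono_interval) auto
    also have "\<dots> \<le> c" using that by (auto simp: is_partition_def)
    finally show ?thesis .
  qed
  have lim\<gamma>: "(\<lambda>n. \<gamma>n n t - \<gamma>n n s) \<longlonglongrightarrow> \<gamma> t - \<gamma> s" if st: "0 \<le> s" "s \<le> t" "t \<le> T" for s t
  proof (rule tendstoI)
    fix e :: real assume "0 < e"
    then have "0 < e / 2" by simp
    show "eventually (\<lambda>n. dist (\<gamma>n n t - \<gamma>n n s) (\<gamma> t - \<gamma> s) < e) sequentially"
    proof (rule eventually_mono[OF close[OF \<open>0 < e / 2\<close>]], elim conjE)
      fix n assume "\<forall>X. is_partition 0 T X \<longrightarrow> psum (incr_sq (\<lambda>u. \<gamma> u - \<gamma>n n u)) X 0 T \<le> (e/2)\<^sup>2"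
      from single[OF this _ _ st] have "(norm ((\<gamma> t - \<gamma>n n t) - (\<gamma> s - \<gamma>n n s)))\<^sup>2 \<le> (e/2)\<^sup>2" by simp
      then have "norm ((\<gamma> t - \<gamma>n n t) - (\<gamma> s - \<gamma>n n s)) \<le> e/2"
        by (rule power2_le_imp_le) (use \<open>0 < e / 2\<close> in simp)
      moreover have "(\<gamma> t - \<gamma>n n t) - (\<gamma> s - \<gamma>n n s) = (\<gamma> t - \<gamma> s) - (\<gamma>n n t - \<gamma>n n s)" by simp
      ultimately show "dist (\<gamma>n n t - \<gamma>n n s) (\<gamma> t - \<gamma> s) < e"
        using \<open>0 < e\<close> by (simp add: dist_norm norm_minus_commute)
    qed
  qed
  have \<alpha>0: "\<alpha> (s, s) = 0" if "0 \<le> s" "s \<le> T" for s using \<alpha> that by (auto simp: C_triangle_def)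
  have lim\<alpha>: "(\<lambda>n. area tns (\<gamma>n n) (s, t)) \<longlonglongrightarrow> \<alpha> (s, t)" if st: "0 \<le> s" "s \<le> t" "t \<le> T" for s t
  proof (rule tendstoI)
    fix e :: real assume "0 < e"
    \<comment> \<open>\<open>close\<close> bounds the area part by the square of its
      argument.\<close>
    then have "0 < sqrt (e / 2)" by simp
    show "eventually (\<lambda>n. dist (area tns (\<gamma>n n) (s, t)) (\<alpha> (s, t)) < e) sequentially"
    proof (rule eventually_mono[OF close[OF \<open>0 < sqrt (e / 2)\<close>]], elim conjE)
      fix n assume "\<forall>X. is_partition 0 T X \<longrightarrow> psum (\<lambda>a b. norm (\<alpha> (a, b) - area tns (\<gamma>n n) (a, b))) X 0 T \<le> (sqrt (e/2))\<^sup>2"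
      moreover have "area tns (\<gamma>n n) (s, s) = 0" using st by (intro area_refl[OF cont var]) auto
      ultimately have "norm (\<alpha> (s, t) - area tns (\<gamma>n n) (s, t)) \<le> (sqrt (e/2))\<^sup>2"
        using single[where F = "\<lambda>a b. norm (\<alpha> (a, b) - area tns (\<gamma>n n) (a, b))", OF _ _ _ st] st
        by (simp add: \<alpha>0)
      then show "dist (area tns (\<gamma>n n) (s, t)) (\<alpha> (s, t)) < e"
        using \<open>0 < e\<close> by (simp add: dist_norm norm_minus_commute)
    qed
  qed
  \<comment> \<open>Chen's relation holds for every \<open>\<gamma>n n\<close>, and each of its
    terms converges because the bracket is continuous.\<close>
  have chen: "\<alpha> (s, t) = \<alpha> (s, u) + \<alpha> (u, t) + (1/2) *\<^sub>R B (\<gamma> u - \<gamma> s) (\<gamma> t - \<gamma> u)"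
    if st: "0 \<le> s" "s \<le> u" "u \<le> t" "t \<le> T" for s u t
  proof (rule LIMSEQ_unique)
    show "(\<lambda>n. area tns (\<gamma>n n) (s, t)) \<longlonglongrightarrow> \<alpha> (s, t)" using st by (intro lim\<alpha>) auto
    show "(\<lambda>n. area tns (\<gamma>n n) (s, t)) \<longlonglongrightarrow> \<alpha> (s, u) + \<alpha> (u, t) + (1/2) *\<^sub>R B (\<gamma> u - \<gamma> s) (\<gamma> t - \<gamma> u)"
      unfolding area_chen[OF cont var st]
      using st by (intro tendsto_add tendsto_scaleR tendsto_const bracket.tendsto lim\<alpha> lim\<gamma>) auto
  qed
  \<comment> \<open>One approximating area within \<open>e / 2\<close> in 1-variation suffices: its
    own sums along fine partitions are at most \<open>e / 2\<close>.\<close>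
  have \<alpha>_van: "\<exists>\<delta>>0. \<forall>X. is_partition 0 T X \<and> gaps_le \<delta> X 0 T \<longrightarrow> psum (\<lambda>a b. norm (\<alpha> (a, b))) X 0 T \<le> e"
    if e: "0 < e" for e
  proof -
    have "0 < sqrt (e / 2)" using e by simp
    from eventually_happens[OF close[OF this]] obtain n where
      n: "\<forall>X. is_partition 0 T X \<longrightarrow> psum (\<lambda>a b. norm (\<alpha> (a, b) - area tns (\<gamma>n n) (a, b))) X 0 T \<le> (sqrt (e/2))\<^sup>2"
      by auto
    obtain \<delta> where \<delta>: "0 < \<delta>" 
      "\<And>X. is_partition 0 T X \<Longrightarrow> gaps_le \<delta> X 0 T \<Longrightarrow> psum (\<lambda>a b. norm (area tns (\<gamma>n n) (a, b))) X 0 T \<le> e / 2"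
      using area_vanishing_1var[OF cont var T0, of "e/2" n] e by auto
    have "psum (\<lambda>a b. norm (\<alpha> (a, b))) X 0 T \<le> e" if X: "is_partition 0 T X" "gaps_le \<delta> X 0 T" for X
    proof -
      have "psum (\<lambda>a b. norm (\<alpha> (a, b))) X 0 T
        \<le> psum (\<lambda>a b. norm (\<alpha> (a, b) - area tns (\<gamma>n n) (a, b)) + norm (area tns (\<gamma>n n) (a, b))) X 0 T"
        by (intro psum_mono) (metis add.commute norm_triangle_sub)
      also have "\<dots> \<le> (sqrt (e/2))\<^sup>2 + e / 2"
        unfolding psum_add using n \<delta>(2) X by (intro add_mono) auto
      also have "\<dots> = e" using e by simp
      finally show ?thesis .
    qed
    then show ?thesis using \<delta>(1) by blast
  qed
  \<comment> \<open>One \<open>\<gamma>n n\<close> at quadratic distance at most 1 is enough. Its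
    increments are bounded by its total variation \<open>K n\<close>, so its quadratic sums are at
    most \<open>K n * K n\<close>.\<close>
  obtain K2 where K2: "0 \<le> K2" "\<And>X. is_partition 0 T X \<Longrightarrow> psum (incr_sq \<gamma>) X 0 T \<le> K2"
  proof -
    from eventually_happens[OF close[of 1]] obtain n where
      n: "\<And>X. is_partition 0 T X \<Longrightarrow> psum (incr_sq (\<lambda>u. \<gamma> u - \<gamma>n n u)) X 0 T \<le> 1" by auto
    have K: "0 \<le> K n" by (rule variation_le_nonneg[OF var T0])
    have "psum (incr_sq \<gamma>) X 0 T \<le> 2 + 2 * (K n)\<^sup>2" if X: "is_partition 0 T X" for X
    proof -
      note Xd = is_partitionD[OF X]
      have "psum (incr_sq \<gamma>) X 0 T \<le> psum (\<lambda>a b. 2 * incr_sq (\<lambda>u. \<gamma> u - \<gamma>n n u) a b + 2 * (K n * incr_norm (\<gamma>n n) a b)) X 0 T"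
      proof (rule psum_mono)
        fix a assume a: "a \<in> X" "0 \<le> a" "a < T"
        let ?b = "nxt X a"
        note m = nxt[OF Xd(1,3) a(3)]
        have "incr_norm (\<gamma>n n) a ?b \<le> K n"
          using variation_le_psum[OF var[of n], of X a ?b] psum_one[OF Xd(1) a(1) m(1,2) nxt_empty[OF Xd(1,3) a(3)], of "incr_norm (\<gamma>n n)"] a m Xd(1)
          by simp
        then have "incr_sq (\<gamma>n n) a ?b \<le> K n * incr_norm (\<gamma>n n) a ?b"
          unfolding power2_eq_square by (intro mult_right_mono) auto
        moreover have "\<gamma> ?b - \<gamma> a = ((\<gamma> ?b - \<gamma>n n ?b) - (\<gamma> a - \<gamma>n n a)) + (\<gamma>n n ?b - \<gamma>n n a)" by simp
        then have "incr_sq \<gamma> a ?b \<le> 2 * incr_sq (\<lambda>u. \<gamma> u - \<gamma>n n u) a ?b + 2 * incr_sq (\<gamma>n n) a ?b"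
          using power2_norm_triangle[of "(\<gamma> ?b - \<gamma>n n ?b) - (\<gamma> a - \<gamma>n n a)" "\<gamma>n n ?b - \<gamma>n n a"] by (simp only:)
        ultimately show "incr_sq \<gamma> a ?b \<le> 2 * incr_sq (\<lambda>u. \<gamma> u - \<gamma>n n u) a ?b + 2 * (K n * incr_norm (\<gamma>n n) a ?b)"
          by linarith
      qed
      also have "\<dots> = 2 * psum (incr_sq (\<lambda>u. \<gamma> u - \<gamma>n n u)) X 0 T + 2 * (K n * psum (incr_norm (\<gamma>n n)) X 0 T)"
        by (simp only: psum_add psum_cmult)
      also have "\<dots> \<le> 2 * 1 + 2 * (K n * K n)"
        using n[OF X] var[of n] X K by (intro add_mono mult_left_mono) (auto simp: variation_le_def)
      finally show ?thesis by (simp add: power2_eq_square)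
    qed
    then show thesis by (intro that[of "2 + 2 * (K n)\<^sup>2"]) auto
  qed
  have "((\<lambda>D. pvar 1 T (\<lambda>x. area tns (pl_interp \<gamma> D) x - \<alpha> x)) \<longlongrightarrow> 0) (mesh_to_0 T)"
    unfolding tendsto_0_ennreal_iff eventually_mesh_to_0
  proof (intro allI impI)
    fix e :: real assume e: "0 < e"
    \<comment> \<open>Each of the three terms of \<open>area_pl_interp_dist\<close> gets
      \<open>e / 3\<close>. The last is at most \<open>\<kappa> * (6 * K2)\<close>, hence 18; the
      \<open>+ 1\<close> covers \<open>K2 = 0\<close>.\<close>
    define \<kappa> where "\<kappa> = e / (18 * (K2 + 1))"
    have \<kappa>: "0 < \<kappa>" using e K2 by (simp add: \<kappa>_def)
    have "\<kappa> * (6 * K2) \<le> \<kappa> * (6 * (K2 + 1))" using \<kappa> by (intro mult_left_mono) auto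
    also have "\<dots> = e / 3" using K2(1) by (simp add: \<kappa>_def field_simps)
    finally have \<kappa>K: "\<kappa> * (6 * K2) \<le> e / 3" .
    \<comment> \<open>With \<kappa> fixed, the middle term is at most
      \<open>(1/\<kappa> + 1) * (4 * \<epsilon>)\<close>, which becomes \<open>e / 3\<close>; the 4
      is that of \<open>pl_interp_close_refined\<close>.\<close>
    define \<epsilon> where "\<epsilon> = e / (12 * (1/\<kappa> + 1))"
    have pos: "0 < 1/\<kappa> + 1" using \<kappa> by (simp add: add_pos_pos)
    have "c * (4 * (e / (12 * c))) = e / 3" if "0 < c" for c using that by (simp add: field_simps)
    from this[OF pos] have \<epsilon>: "0 < \<epsilon>" "(1/\<kappa> + 1) * (4 * \<epsilon>) = e / 3"
      using e pos unfolding \<epsilon>_def by simp_all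
    obtain \<delta>1 where \<delta>1: "0 < \<delta>1" "\<forall>X. is_partition 0 T X \<and> gaps_le \<delta>1 X 0 T \<longrightarrow> psum (incr_sq \<gamma>) X 0 T \<le> \<epsilon>"
      using C0_pvar_2_modulus[OF \<gamma> \<epsilon>(1)] by blast
    obtain \<delta>2 where \<delta>2: "0 < \<delta>2"
      "\<forall>X. is_partition 0 T X \<and> gaps_le \<delta>2 X 0 T \<longrightarrow> psum (\<lambda>a b. norm (\<alpha> (a, b))) X 0 T \<le> e / 3"
      using \<alpha>_van[of "e/3"] e by auto
    have "pvar 1 T (\<lambda>x. area tns (pl_interp \<gamma> D) x - \<alpha> x) \<le> ennreal e"
      if D: "time_partition 0 T D" "mesh D \<le> min \<delta>1 \<delta>2" for D
    proof -
      have g: "gaps_le \<delta>1 (set D) 0 T" "gaps_le \<delta>2 (set D) 0 T"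
        using D \<delta>1(1) \<delta>2(1) mesh_le_iff[OF D(1), of \<delta>1] mesh_le_iff[OF D(1), of \<delta>2] by auto
      have "psum (\<lambda>a b. norm (area tns (pl_interp \<gamma> D) (a, b) - \<alpha> (a, b))) E 0 T \<le> e"
        if E: "is_partition 0 T E" for E
      proof -
        let ?Z = "E \<union> set D"
        have X: "is_partition 0 T (set D)" by (rule time_partition_set(1)[OF D(1)])
        have Z: "is_partition 0 T ?Z" using E X by (rule is_partition_Un)
        have "gaps_le \<delta>2 ?Z 0 T"
          using gaps_le_refine[OF g(2), of ?Z] is_partitionD[OF X] is_partitionD[OF Z] by auto
        then have "psum (\<lambda>a b. norm (\<alpha> (a, b))) ?Z 0 T \<le> e / 3" using \<delta>2 Z by blast
        moreover have "(1/\<kappa> + 1) * psum (incr_sq (\<lambda>u. \<gamma> u - pl_interp \<gamma> D u)) ?Z 0 T \<le> (1/\<kappa> + 1) * (4 * \<epsilon>)"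
          using pl_interp_close_refined[OF D(1) g(1) \<delta>1(2) Z] pos by (intro mult_left_mono) auto
        moreover have "\<kappa> * (4 * psum (incr_sq \<gamma>) E 0 T + 2 * psum (incr_sq \<gamma>) ?Z 0 T) \<le> \<kappa> * (6 * K2)"
          using K2(2)[OF E] K2(2)[OF Z] \<kappa> by (intro mult_left_mono) auto
        ultimately show ?thesis
          using area_pl_interp_dist[where \<alpha> = \<alpha> and \<gamma> = \<gamma>, OF D(1) chen E \<kappa>] \<kappa>K \<epsilon>(2) by linarith
      qed
      then show ?thesis using e by (simp add: pvar_1_le_iff)
    qed
    then show "\<exists>\<delta>>0. \<forall>D. time_partition 0 T D \<longrightarrow> mesh D \<le> \<delta> \<longrightarrow>
        pvar 1 T (\<lambda>x. area tns (pl_interp \<gamma> D) x - \<alpha> x) \<le> ennreal e"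
      using \<delta>1(1) \<delta>2(1) by (intro exI[of _ "min \<delta>1 \<delta>2"]) auto
  qed
  then show ?thesis using \<alpha> by (auto simp: areas_converge_in_1var_def)
qed

end

theorem theorem23:
  fixes tns :: "'v::banach \<Rightarrow> 'v \<Rightarrow> 'w::banach"
    and T :: real
    and \<gamma> :: "real \<Rightarrow> 'v"
  assumes "completed_tensor_product tns"
    and "T > 0"
    and "\<gamma> \<in> C0_pvar 2 T"
  shows "\<gamma> \<in> G2 tns T \<longleftrightarrow> areas_converge_in_1var tns T \<gamma>"
proof -
  interpret bounded_tensor tns
    using assms(1) by unfold_locales (auto simp: completed_tensor_product_def)
  show ?thesis
    using areas_converge_imp_geometric[OF assms(2,3)] geometric_imp_areas_converge[OF assms(2)] by blast
qed

end
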